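(* There is a polynomial-time $3$-approximation algorithm for the lower-bounded $k$-supplier problem (defined in the context): on every instance admitting a feasible solution it returns a feasible solution of cost at most $3$ times the optimal cost.
   Context: Lower-bounded $k$-supplier: the input is a finite facility set $\mathcal F$ and a finite client set $\mathcal D$ in a common metric space with distances $c(i,j)$, nonnegative integer lower bounds $\{L_i\}_{i\in\mathcal F}$, and a positive integer $k$. A feasible solution is a pair $(S,\sigma)$ with $S\subseteq\mathcal F$, $|S|\le k$, $\sigma:\mathcal D\to S$, and $|\sigma^{-1}(i)|\ge L_i$ for all $i\in S$. Its cost is $\max_{i\in S}\max_{j\in\sigma^{-1}(i)}c(i,j)$, to be minimized. *)

theory Defs
  imports
    "HOL-Analysis.Abstract_Metric_Spaces"
    "HOL-Computational_Algebra.Polynomial"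
    "HOL-Library.FuncSet"
    "HOL-Library.Log_Nat"
begin

section \<open>The lower-bounded k-supplier problem\<close>

definition feasible ::
  "'f set \<Rightarrow> 'd set \<Rightarrow> ('f \<Rightarrow> nat) \<Rightarrow> nat \<Rightarrow> 'f set \<Rightarrow> ('d \<Rightarrow> 'f) \<Rightarrow> bool" where
  "feasible F D L k S \<sigma> \<longleftrightarrow>
     S \<subseteq> F \<and> card S \<le> k \<and> \<sigma> \<in> D \<rightarrow> S \<and> (\<forall>i\<in>S. L i \<le> card {j\<in>D. \<sigma> j = i})"

text \<open>The two nested maxima are merged into one. The element 0 only matters when there are no
  clients, since distances are nonnegative.\<close>

definition cost :: "('f \<Rightarrow> 'd \<Rightarrow> real) \<Rightarrow> 'd set \<Rightarrow> 'f set \<Rightarrow> ('d \<Rightarrow> 'f) \<Rightarrow> real" where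
  "cost c D S \<sigma> = Max (insert 0 {c i j | i j. i \<in> S \<and> j \<in> D \<and> \<sigma> j = i})"

definition opt_cost ::
  "'f set \<Rightarrow> 'd set \<Rightarrow> ('f \<Rightarrow> 'd \<Rightarrow> real) \<Rightarrow> ('f \<Rightarrow> nat) \<Rightarrow> nat \<Rightarrow> real" where
  "opt_cost F D c L k = Inf {cost c D S \<sigma> | S \<sigma>. feasible F D L k S \<sigma>}"

text \<open>For finite F and D there are only finitely many costs, so the infimum is a minimum.\<close>

lemma opt_cost_attained:
  assumes F: "finite F" and D: "finite D" and ex: "\<exists>S \<sigma>. feasible F D L k S \<sigma>"
  shows "\<exists>S \<sigma>. feasible F D L k S \<sigma> \<and> cost c D S \<sigma> = opt_cost F D c L k"
proof -
  let ?C = "{cost c D S \<sigma> | S \<sigma>. feasible F D L k S \<sigma>}"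
  let ?V = "insert 0 ((\<lambda>(i, j). c i j) ` (F \<times> D))"
  have finV: "finite ?V" using F D by simp
  have "cost c D S \<sigma> \<in> ?V" if "feasible F D L k S \<sigma>" for S \<sigma>
  proof -
    let ?A = "insert 0 {c i j | i j. i \<in> S \<and> j \<in> D \<and> \<sigma> j = i}"
    have sub: "?A \<subseteq> ?V" using that unfolding feasible_def by auto
    then have "finite ?A" using finV by (rule finite_subset)
    then have "Max ?A \<in> ?A" by (rule Max_in) simp
    then show ?thesis using sub unfolding cost_def by blast
  qed
  then have "?C \<subseteq> ?V" by blast
  then have "finite ?C" using finV by (rule finite_subset)
  moreover have "?C \<noteq> {}" using ex by blast
  ultimately have "Inf ?C \<in> ?C" using Min_in[of ?C] cInf_eq_Min[of ?C] by simp
  then obtain S \<sigma> where "feasible F D L k S \<sigma>" "Inf ?C = cost c D S \<sigma>" by blast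
  then show ?thesis unfolding opt_cost_def by metis
qed

section \<open>Instances as input data\<close>

text \<open>The points of the metric space, the facilities and the clients are numbered from 0.
  Facility i is located at point \<open>inst_fac I ! i\<close> and client j at point \<open>inst_cli I ! j\<close>.
  Repeated entries are allowed, so facilities and clients may share locations; disjoint, overlapping
  or equal sets of points are the case of distinct lists.
  Distances are rational so that an instance is a finite object with a binary encoding.\<close>

record inst =
  inst_points :: nat
  inst_dist :: "nat \<Rightarrow> nat \<Rightarrow> rat"
  inst_fac :: "nat list"
  inst_cli :: "nat list"
  inst_lb :: "nat list"
  inst_k :: nat

text \<open>Locale \<open>Metric_space\<close> requires nonnegativity and symmetry also off the carrier. This
  restricts nothing, since \<open>inst_dist\<close> is used only on the carrier.\<close>

definition valid_inst :: "inst \<Rightarrow> bool" where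
  "valid_inst I \<longleftrightarrow>
     Metric_space {..<inst_points I} (\<lambda>x y. real_of_rat (inst_dist I x y)) \<and>
     set (inst_fac I) \<subseteq> {..<inst_points I} \<and>
     set (inst_cli I) \<subseteq> {..<inst_points I} \<and>
     length (inst_lb I) = length (inst_fac I) \<and>
     0 < inst_k I"

definition facilities :: "inst \<Rightarrow> nat set" where
  "facilities I = {..<length (inst_fac I)}"

definition clients :: "inst \<Rightarrow> nat set" where
  "clients I = {..<length (inst_cli I)}"

definition fc_dist :: "inst \<Rightarrow> nat \<Rightarrow> nat \<Rightarrow> real" where
  "fc_dist I i j = real_of_rat (inst_dist I (inst_fac I ! i) (inst_cli I ! j))"

definition inst_feasible :: "inst \<Rightarrow> nat set \<Rightarrow> (nat \<Rightarrow> nat) \<Rightarrow> bool" where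
  "inst_feasible I = feasible (facilities I) (clients I) (\<lambda>i. inst_lb I ! i) (inst_k I)"

definition inst_cost :: "inst \<Rightarrow> nat set \<Rightarrow> (nat \<Rightarrow> nat) \<Rightarrow> real" where
  "inst_cost I = cost (fc_dist I) (clients I)"

definition inst_opt :: "inst \<Rightarrow> real" where
  "inst_opt I = opt_cost (facilities I) (clients I) (fc_dist I) (\<lambda>i. inst_lb I ! i) (inst_k I)"

text \<open>A rational is written as the numerator and the positive denominator of its reduced fraction.
  On valid instances numerators are nonnegative, so \<open>nat\<close> loses nothing.\<close>

definition encode_rat :: "rat \<Rightarrow> nat list" where
  "encode_rat q = (case quotient_of q of (a, b) \<Rightarrow> [nat a, nat b])"

definition encode :: "inst \<Rightarrow> nat list" where
  "encode I =
     [inst_points I, length (inst_fac I), length (inst_cli I), inst_k I]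
     @ inst_fac I @ inst_lb I @ inst_cli I
     @ concat [encode_rat (inst_dist I x y). x \<leftarrow> [0..<inst_points I], y \<leftarrow> [0..<inst_points I]]"

text \<open>A solution is output as one flag per facility (nonzero iff it is opened), followed by
  one facility index per client.\<close>

definition decode_open :: "inst \<Rightarrow> (nat \<Rightarrow> nat) \<Rightarrow> nat set" where
  "decode_open I out = {i \<in> facilities I. out i \<noteq> 0}"

definition decode_assign :: "inst \<Rightarrow> (nat \<Rightarrow> nat) \<Rightarrow> nat \<Rightarrow> nat" where
  "decode_assign I out j = out (length (inst_fac I) + j)"

section \<open>Polynomial time\<close>

text \<open>Structured programs for a random access machine over natural numbers, with finitely many
  named arrays (a scalar is the cell 0 of an array), charged by the logarithmic cost criterion:
  every operation pays for the bit length of the operands and of the result. With this charge,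
  running times agree with those of multitape Turing machines up to a polynomial,
  multiplication included. Subtraction is truncated; as a condition, a nonzero value means true.\<close>

datatype aexp =
    Num nat
  | Cell string aexp
  | Plus aexp aexp
  | Minus aexp aexp
  | Times aexp aexp

datatype com =
    Skip
  | Assign string aexp aexp
  | Seq com com
  | If aexp com com
  | While aexp com

type_synonym store = "string \<Rightarrow> nat \<Rightarrow> nat"

definition nbits :: "nat \<Rightarrow> nat" where
  "nbits n = 1 + floorlog 2 n"

fun aval :: "aexp \<Rightarrow> store \<Rightarrow> nat" where
  "aval (Num n) s = n"
| "aval (Cell x e) s = s x (aval e s)"
| "aval (Plus a b) s = aval a s + aval b s"
| "aval (Minus a b) s = aval a s - aval b s"
| "aval (Times a b) s = aval a s * aval b s"

text \<open>The cost of a subexpression is at least the bit length of its value, so operands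
  (array indices included) are paid for by the recursive calls.\<close>

fun atime :: "aexp \<Rightarrow> store \<Rightarrow> nat" where
  "atime (Num n) s = nbits n"
| "atime (Cell x e) s = atime e s + nbits (aval (Cell x e) s)"
| "atime (Plus a b) s = atime a s + atime b s + nbits (aval (Plus a b) s)"
| "atime (Minus a b) s = atime a s + atime b s + nbits (aval (Minus a b) s)"
| "atime (Times a b) s = atime a s + atime b s + nbits (aval (Times a b) s)"

text \<open>\<open>exec c s t s'\<close>: program c started in store s halts in store s' after time t.\<close>

inductive exec :: "com \<Rightarrow> store \<Rightarrow> nat \<Rightarrow> store \<Rightarrow> bool" where
  Skip: "exec Skip s 1 s"
| Assign: "exec (Assign x i e) s (1 + atime i s + atime e s)
             (s(x := (s x)(aval i s := aval e s)))"
| Seq: "exec c1 s t1 s1 \<Longrightarrow> exec c2 s1 t2 s2 \<Longrightarrow> exec (Seq c1 c2) s (t1 + t2) s2"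
| IfTrue: "aval b s \<noteq> 0 \<Longrightarrow> exec c1 s t s' \<Longrightarrow> exec (If b c1 c2) s (1 + atime b s + t) s'"
| IfFalse: "aval b s = 0 \<Longrightarrow> exec c2 s t s' \<Longrightarrow> exec (If b c1 c2) s (1 + atime b s + t) s'"
| WhileFalse: "aval b s = 0 \<Longrightarrow> exec (While b c) s (1 + atime b s) s"
| WhileTrue: "aval b s \<noteq> 0 \<Longrightarrow> exec c s t1 s1 \<Longrightarrow> exec (While b c) s1 t2 s2 \<Longrightarrow>
             exec (While b c) s (1 + atime b s + t1 + t2) s2"

lemma exec_deterministic:
  "exec c s t s' \<Longrightarrow> exec c s u s'' \<Longrightarrow> t = u \<and> s' = s''"
proof (induction arbitrary: u s'' rule: exec.induct)
  case (Skip s)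
  then show ?case by (auto elim: exec.cases)
next
  case (Assign x i e s)
  then show ?case by (auto elim: exec.cases)
next
  case (Seq c1 s t1 s1 c2 t2 s2)
  from Seq.prems obtain v1 r v2 where "exec c1 s v1 r" "exec c2 r v2 s''" "u = v1 + v2"
    by (cases rule: exec.cases) simp_all
  with Seq.IH(1)[of v1 r] Seq.IH(2)[of v2 s''] show ?case by simp
next
  case (IfTrue b s c1 t s' c2)
  from IfTrue.prems IfTrue.hyps obtain v where "exec c1 s v s''" "u = 1 + atime b s + v"
    by (cases rule: exec.cases) simp_all
  with IfTrue.IH[of v s''] show ?case by simp
next
  case (IfFalse b s c2 t s' c1)
  from IfFalse.prems IfFalse.hyps obtain v where "exec c2 s v s''" "u = 1 + atime b s + v"
    by (cases rule: exec.cases) simp_all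
  with IfFalse.IH[of v s''] show ?case by simp
next
  case (WhileFalse b s c)
  from WhileFalse.prems WhileFalse.hyps show ?case
    by (cases rule: exec.cases) simp_all
next
  case (WhileTrue b s c t1 s1 t2 s2)
  from WhileTrue.prems WhileTrue.hyps(1) obtain v1 r v2
    where "exec c s v1 r" "exec (While b c) r v2 s''" "u = 1 + atime b s + v1 + v2"
    by (cases rule: exec.cases) simp_all
  with WhileTrue.IH(1)[of v1 r] WhileTrue.IH(2)[of v2 s''] show ?case by simp
qed

definition init_store :: "nat list \<Rightarrow> store" where
  "init_store xs = (\<lambda>x i. if x = ''in'' \<and> i < length xs then xs ! i else 0)"

definition input_size :: "nat list \<Rightarrow> nat" where
  "input_size xs = (\<Sum>x\<leftarrow>xs. nbits x)"

definition poly_time_on :: "com \<Rightarrow> nat list set \<Rightarrow> bool" where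
  "poly_time_on c X \<longleftrightarrow>
     (\<exists>p :: nat poly. \<forall>xs\<in>X. \<exists>t s. exec c (init_store xs) t s \<and> t \<le> poly p (input_size xs))"

definition returns :: "com \<Rightarrow> nat list \<Rightarrow> (nat \<Rightarrow> nat) \<Rightarrow> bool" where
  "returns c xs out \<longleftrightarrow> (\<exists>t s. exec c (init_store xs) t s \<and> s ''out'' = out)"

end

(* For a guessed radius B, scan the clients. If client j is farther than 3B from every facility
   opened so far, open some facility i within B of j whose B-neighbourhood has at least L_i clients.
   A later neighbourhood cannot meet an earlier one, as a common client would put j within 3B of the
   earlier facility. So assigning each client to the opened facility within B, if there is one, and
   otherwise to one within 3B, respects the lower bounds. If a solution of radius B exists, its
   facility serving j can always be opened, and the clients that caused an opening are served by
   different facilities of that solution, so at most k facilities are opened. The optimum is one of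
   the facility-client distances; the smallest one that succeeds is at most the optimum.

   Loops bounded by the numbers of facilities and clients, with assignments that lengthen a number
   by at most one bit, run in polynomial time. *)
theory Submission
  imports Defs
begin

section \<open>Bounded loop programs\<close>

text \<open>The execution relation carries time and result together. To separate the two concerns,
  programs are written in a bounded loop language with a total semantics \<open>run\<close>;
  correctness is proved about \<open>run\<close> alone, and one simulation lemma supplies
  termination and time for every program of the language. The logarithmic cost shapes this language.
  A polynomial number of steps is not enough, since repeated squaring produces numbers of
  exponential length; \<open>slow_growing\<close> therefore does not let a product be stored, while
  products stay available in conditions and array indices. Loop bounds must be lengths of input
  lists, since k or a numerator, written in binary, may be exponential in the input size. The
  constant 3 comes from paths facility - client - facility - client with three legs of length at
  most B. Such a path arises twice: from a common client of two neighbourhoods, and from a common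
  server of two clients. Success of the greedy scan at a radius below the optimum does no harm: it
  only lowers the recorded radius, and comes with a solution of cost at most three times that
  radius.\<close>

datatype lp =
    LSkip
  | LAssign string aexp aexp
  | LSeq lp lp
  | LIf aexp lp lp
  | LFor string nat lp

abbreviation upd :: "store \<Rightarrow> string \<Rightarrow> nat \<Rightarrow> store" where
  "upd s x v \<equiv> s(x := (s x)(0 := v))"

abbreviation scalar :: "string \<Rightarrow> aexp" where
  "scalar x \<equiv> Cell x (Num 0)"

text \<open>\<open>LFor x m b\<close> lets x run through 0, 1, ..., up to the m-th input number.\<close>

fun compile :: "lp \<Rightarrow> com" where
  "compile LSkip = Skip"
| "compile (LAssign x i e) = Assign x i e"
| "compile (LSeq p q) = Seq (compile p) (compile q)"
| "compile (LIf e p q) = If e (compile p) (compile q)"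
| "compile (LFor x m b) =
     Seq (Assign x (Num 0) (Num 0))
       (While (Minus (Cell ''in'' (Num m)) (scalar x))
         (Seq (compile b) (Assign x (Num 0) (Plus (scalar x) (Num 1)))))"

text \<open>Total by structural recursion, because a loop bound is read once on entry and the loop
  becomes a fold. The compiled while loop rereads bound and counter in every round; the two agree
  because a well-formed body changes neither.\<close>

fun run :: "lp \<Rightarrow> store \<Rightarrow> store" where
  "run LSkip s = s"
| "run (LAssign x i e) s = s(x := (s x)(aval i s := aval e s))"
| "run (LSeq p q) s = run q (run p s)"
| "run (LIf e p q) s = (if aval e s \<noteq> 0 then run p s else run q s)"
| "run (LFor x m b) s =
     upd (fold (\<lambda>i s. run b (upd s x i)) [0..<s ''in'' m] s) x (s ''in'' m)"

fun mods :: "lp \<Rightarrow> string set" where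
  "mods LSkip = {}"
| "mods (LAssign x i e) = {x}"
| "mods (LSeq p q) = mods p \<union> mods q"
| "mods (LIf e p q) = mods p \<union> mods q"
| "mods (LFor x m b) = insert x (mods b)"

text \<open>Assignments may lengthen a number by one bit only, which keeps all numbers short.\<close>

fun slow_growing :: "aexp \<Rightarrow> bool" where
  "slow_growing (Num n) = (n \<le> 1)"
| "slow_growing (Cell x e) = True"
| "slow_growing (Plus (Cell x e) (Num n)) = (n \<le> 1)"
| "slow_growing (Minus a b) = slow_growing a"
| "slow_growing _ = False"

text \<open>Input cells 1 and 2 hold the numbers of facilities and of clients.\<close>

fun well_formed :: "lp \<Rightarrow> bool" where
  "well_formed LSkip = True"
| "well_formed (LAssign x i e) = (x \<noteq> ''in'' \<and> slow_growing e)"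
| "well_formed (LSeq p q) = (well_formed p \<and> well_formed q)"
| "well_formed (LIf e p q) = (well_formed p \<and> well_formed q)"
| "well_formed (LFor x m b) = (x \<noteq> ''in'' \<and> x \<notin> mods b \<and> m \<in> {1, 2} \<and> well_formed b)"

lemma run_frame: "y \<notin> mods p \<Longrightarrow> run p s y = s y"
proof (induction p arbitrary: s)
  case (LFor x m b)
  have "fold (\<lambda>i s. run b (upd s x i)) xs s' y = s' y" for xs s'
    using LFor by (induction xs arbitrary: s') auto
  then show ?case using LFor.prems by simp
qed auto

lemma well_formed_in_notin_mods: "well_formed p \<Longrightarrow> ''in'' \<notin> mods p"
  by (induction p) auto

text \<open>The invariant rule for loops: \<open>Q i\<close> describes the store before round i. The
  frame facts are handed to each obligation, so that \<open>Q\<close> need only mention what the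
  loop changes. \<open>R\<close> sees the counter at its final value n.\<close>

lemma run_For:
  assumes n: "s ''in'' m = n"
    and base: "Q 0 s"
    and step: "\<And>i s'. i < n \<Longrightarrow> Q i s' \<Longrightarrow> (\<And>y. y \<notin> insert x (mods b) \<Longrightarrow> s' y = s y) \<Longrightarrow>
      Q (Suc i) (run b (upd s' x i))"
    and final: "\<And>s'. Q n s' \<Longrightarrow> (\<And>y. y \<notin> insert x (mods b) \<Longrightarrow> s' y = s y) \<Longrightarrow> R (upd s' x n)"
  shows "R (run (LFor x m b) s)"
proof -
  let ?h = "\<lambda>i. fold (\<lambda>i s. run b (upd s x i)) [0..<i] s"
  have frame: "?h i y = s y" if "y \<notin> insert x (mods b)" for i y
    using that by (induction i) (auto simp: run_frame)
  have "i \<le> n \<Longrightarrow> Q i (?h i)" for i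
  proof (induction i)
    case 0
    then show ?case using base by simp
  next
    case (Suc i)
    then show ?case using step[of i "?h i"] frame by (simp del: fun_upd_apply)
  qed
  then show ?thesis using final[of "?h n"] frame n by simp
qed

section \<open>Running time of bounded loop programs\<close>

lemma floorlog2_le_iff: "floorlog 2 n \<le> w \<longleftrightarrow> n < 2 ^ w"
  by (simp add: floorlog_le_iff)

lemma less_two_power_nbits: "n < 2 ^ (nbits n - 1)"
  unfolding nbits_def using floorlog2_le_iff[of n "floorlog 2 n"] by simp

lemma nbits_leI: "n < 2 ^ w \<Longrightarrow> nbits n \<le> Suc w"
  unfolding nbits_def using floorlog2_le_iff by simp

lemma nbits_pos: "1 \<le> nbits n"
  unfolding nbits_def by simp

lemma nbits_mono: "m \<le> n \<Longrightarrow> nbits m \<le> nbits n"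
  unfolding nbits_def by (simp add: floorlog_mono)

text \<open>The extra 1 in \<open>nbits\<close> absorbs the carry: the values lie below 2^u and 2^v
  with u and v one less than their bit lengths.\<close>

lemma nbits_add: "nbits (a + b) \<le> nbits a + nbits b"
proof -
  obtain u v where u: "nbits a = Suc u" and v: "nbits b = Suc v"
    using nbits_pos by (metis Suc_le_D One_nat_def)
  have "a < 2 ^ u" "b < 2 ^ v" using less_two_power_nbits[of a] less_two_power_nbits[of b] u v by auto
  moreover have "(2::nat) ^ u \<le> 2 ^ (u + v)" "(2::nat) ^ v \<le> 2 ^ (u + v)" by simp_all
  ultimately have "a + b < 2 ^ Suc (u + v)" unfolding power_Suc by linarith
  then show ?thesis using nbits_leI[of "a + b" "Suc (u + v)"] u v by simp
qed

lemma nbits_mult: "nbits (a * b) \<le> nbits a + nbits b"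
proof -
  obtain u v where u: "nbits a = Suc u" and v: "nbits b = Suc v"
    using nbits_pos by (metis Suc_le_D One_nat_def)
  have "a < 2 ^ u" "b < 2 ^ v" using less_two_power_nbits[of a] less_two_power_nbits[of b] u v by auto
  then have "a * b < 2 ^ (u + v)" unfolding power_add by (intro mult_strict_mono) auto
  then show ?thesis using nbits_leI[of "a * b" "u + v"] u v by simp
qed

lemma nbits_Suc: "nbits (Suc a) \<le> Suc (nbits a)"
proof -
  obtain u where u: "nbits a = Suc u" using nbits_pos by (metis Suc_le_D One_nat_def)
  have "a < 2 ^ u" using less_two_power_nbits[of a] u by auto
  then have "Suc a < 2 ^ Suc u" unfolding power_Suc by linarith
  then show ?thesis using nbits_leI[of "Suc a" "Suc u"] u by simp
qed

lemma nbits_0: "nbits 0 = 1"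
  unfolding nbits_def by (simp add: floorlog_def)

lemma nbits_1: "nbits (Suc 0) = 2"
  unfolding nbits_def by (simp add: floorlog_def)

text \<open>A bound on the bit length of a value that depends on the store only through the common
  bit length b of its cells. For a fixed expression it is a polynomial in b.\<close>

fun val_bits :: "aexp \<Rightarrow> nat \<Rightarrow> nat" where
  "val_bits (Num n) b = nbits n"
| "val_bits (Cell x e) b = b"
| "val_bits (Plus d e) b = val_bits d b + val_bits e b"
| "val_bits (Minus d e) b = val_bits d b"
| "val_bits (Times d e) b = val_bits d b + val_bits e b"

fun time_bits :: "aexp \<Rightarrow> nat \<Rightarrow> nat" where
  "time_bits (Num n) b = nbits n"
| "time_bits (Cell x e) b = time_bits e b + b"
| "time_bits (Plus d e) b = time_bits d b + time_bits e b + val_bits (Plus d e) b"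
| "time_bits (Minus d e) b = time_bits d b + time_bits e b + val_bits (Minus d e) b"
| "time_bits (Times d e) b = time_bits d b + time_bits e b + val_bits (Times d e) b"

definition store_bits :: "store \<Rightarrow> nat \<Rightarrow> bool" where
  "store_bits s b \<longleftrightarrow> (\<forall>x i. nbits (s x i) \<le> b)"

lemma store_bits_mono: "store_bits s b \<Longrightarrow> b \<le> b' \<Longrightarrow> store_bits s b'"
  unfolding store_bits_def using le_trans by blast

lemma store_bits_pos: "store_bits s b \<Longrightarrow> 1 \<le> b"
  unfolding store_bits_def using nbits_pos le_trans by blast

lemma store_bits_upd: "store_bits s b \<Longrightarrow> nbits v \<le> b \<Longrightarrow> store_bits (s(x := (s x)(i := v))) b"
  unfolding store_bits_def by simp

lemma nbits_aval: "store_bits s b \<Longrightarrow> nbits (aval e s) \<le> val_bits e b"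
proof (induction e)
  case (Cell x e)
  then show ?case by (simp add: store_bits_def)
next
  case (Plus d e)
  then show ?case using nbits_add[of "aval d s" "aval e s"] by simp
next
  case (Minus d e)
  then show ?case using nbits_mono[of "aval d s - aval e s" "aval d s"] by simp
next
  case (Times d e)
  then show ?case using nbits_mult[of "aval d s" "aval e s"] by simp
qed simp

lemma atime_le: "store_bits s b \<Longrightarrow> atime e s \<le> time_bits e b"
proof (induction e)
  case (Cell x e)
  then show ?case using nbits_aval[of s b "Cell x e"] by simp
next
  case (Plus d e)
  then show ?case using nbits_aval[of s b "Plus d e"] by simp
next
  case (Minus d e)
  then show ?case using nbits_aval[of s b "Minus d e"] by simp
next
  case (Times d e)
  then show ?case using nbits_aval[of s b "Times d e"] by simp
qed simp

lemma nbits_slow_growing: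
  "slow_growing e \<Longrightarrow> store_bits s b \<Longrightarrow> nbits (aval e s) \<le> Suc b"
proof (induction e rule: slow_growing.induct)
  case (1 n)
  then have "n = 0 \<or> n = 1" by auto
  then show ?case using store_bits_pos[OF 1(2)] by (auto simp: nbits_0 nbits_1)
next
  case (2 x e)
  then show ?case by (simp add: store_bits_def le_SucI)
next
  case (3 x e n)
  have "nbits (s x (aval e s)) \<le> b" using 3 by (simp add: store_bits_def)
  moreover from 3 have "n = 0 \<or> n = 1" by auto
  ultimately show ?case using nbits_Suc[of "s x (aval e s)"] by auto
next
  case (4 a c)
  then show ?case using nbits_mono[of "aval a s - aval c s" "aval a s"] by simp
qed auto

text \<open>Here n bounds the number of iterations of every loop, and b the bit length of every stored
  number.\<close>

fun steps :: "lp \<Rightarrow> nat \<Rightarrow> nat" where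
  "steps LSkip n = 0"
| "steps (LAssign x i e) n = 1"
| "steps (LSeq p q) n = steps p n + steps q n"
| "steps (LIf e p q) n = steps p n + steps q n"
| "steps (LFor x m p) n = n * Suc (steps p n)"

fun time_bound :: "lp \<Rightarrow> nat \<Rightarrow> nat \<Rightarrow> nat" where
  "time_bound LSkip n b = 1"
| "time_bound (LAssign x i e) n b = 1 + time_bits i b + time_bits e b"
| "time_bound (LSeq p q) n b = time_bound p n b + time_bound q n b"
| "time_bound (LIf e p q) n b = 1 + time_bits e b + time_bound p n b + time_bound q n b"
| "time_bound (LFor x m p) n b =
     (1 + time_bits (Num 0) b + time_bits (Num 0) b) +
     (1 + time_bits (Minus (Cell ''in'' (Num m)) (scalar x)) b) +
     n * ((1 + time_bits (Minus (Cell ''in'' (Num m)) (scalar x)) b) + (time_bound p n b +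
       (1 + time_bits (Num 0) b + time_bits (Plus (scalar x) (Num 1)) b)))"

text \<open>\<open>steps p n\<close> bounds the number of executed assignments that can lengthen a
  number, each by one bit at most; setting a loop counter to 0 lengthens nothing. B stays fixed
  through the induction while b grows along the execution: it bounds the bit length in all
  intermediate stores, and thereby the time of every single step.\<close>

lemma exec_compile:
  assumes "well_formed p" "store_bits s b" "s ''in'' 1 \<le> n" "s ''in'' 2 \<le> n" "b + steps p n \<le> B"
  shows "(\<exists>t. exec (compile p) s t (run p s) \<and> t \<le> time_bound p n B) \<and>
    store_bits (run p s) (b + steps p n)"
  using assms
proof (induction p arbitrary: s b)
  case LSkip
  then show ?case by (auto intro: exec.Skip)
next
  case (LAssign x i e)
  have "store_bits s B" using LAssign.prems store_bits_mono by (meson add_leE)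
  then have "1 + atime i s + atime e s \<le> time_bound (LAssign x i e) n B"
    using atime_le[of s B i] atime_le[of s B e] by simp
  moreover have "store_bits (run (LAssign x i e) s) (Suc b)"
    using LAssign.prems store_bits_mono[of s b "Suc b"] nbits_slow_growing[of e s b]
    by (simp add: store_bits_upd)
  ultimately show ?case using exec.Assign[of x i e s]
    by (auto simp del: fun_upd_apply)
next
  case (LSeq p q)
  have in_eq: "run p s ''in'' = s ''in''" using LSeq.prems(1) well_formed_in_notin_mods run_frame by simp
  obtain t1 where t1: "exec (compile p) s t1 (run p s)" "t1 \<le> time_bound p n B"
    and b1: "store_bits (run p s) (b + steps p n)"
    using LSeq.IH(1)[of s b] LSeq.prems by auto
  obtain t2 where t2: "exec (compile q) (run p s) t2 (run q (run p s))" "t2 \<le> time_bound q n B"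
    and b2: "store_bits (run q (run p s)) (b + steps p n + steps q n)"
    using LSeq.IH(2)[of "run p s" "b + steps p n"] LSeq.prems b1 in_eq by auto
  show ?case using exec.Seq[OF t1(1) t2(1)] t1(2) t2(2) b2
    by (auto simp: add.assoc intro!: exI[of _ "t1 + t2"])
next
  case (LIf e p q)
  have e: "atime e s \<le> time_bits e B"
    using LIf.prems store_bits_mono[of s b B] by (intro atime_le) simp
  show ?case
  proof (cases "aval e s = 0")
    case True
    obtain t where t: "exec (compile q) s t (run q s)" "t \<le> time_bound q n B"
      and b1: "store_bits (run q s) (b + steps q n)"
      using LIf.IH(2)[of s b] LIf.prems by auto
    show ?thesis using exec.IfFalse[OF True t(1), of "compile p"] t(2) e True
        store_bits_mono[OF b1, of "b + steps (LIf e p q) n"]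
      by (auto intro!: exI[of _ "1 + atime e s + t"])
  next
    case False
    obtain t where t: "exec (compile p) s t (run p s)" "t \<le> time_bound p n B"
      and b1: "store_bits (run p s) (b + steps p n)"
      using LIf.IH(1)[of s b] LIf.prems by auto
    show ?thesis using exec.IfTrue[OF False t(1), of "compile q"] t(2) e False
        store_bits_mono[OF b1, of "b + steps (LIf e p q) n"]
      by (auto intro!: exI[of _ "1 + atime e s + t"])
  qed
next
  case (LFor x m p)
  define N where "N = s ''in'' m"
  \<comment> \<open>\<open>h i\<close> is the store in which the guard is tested for the i-th time,
    counting from 0. \<open>st (Suc i)\<close> is the store after that round's body, where the
    counter still holds i and awaits its increment.\<close>
  define st where "st i = fold (\<lambda>i s. run p (upd s x i)) [0..<i] s" for i
  define h where "h i = upd (st i) x i" for i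
  define G where "G = Minus (Cell ''in'' (Num m)) (scalar x)"
  define I where "I = Assign x (Num 0) (Plus (scalar x) (Num 1))"
  define W where "W = While G (Seq (compile p) I)"
  define C where "C = (1 + time_bits G B) + (time_bound p n B +
       (1 + time_bits (Num 0) B + time_bits (Plus (scalar x) (Num 1)) B))"
  have well_formed: "x \<noteq> ''in''" "x \<notin> mods p" "m = 1 \<or> m = 2" "well_formed p" using LFor.prems(1) by auto
  have Nn: "N \<le> n" using well_formed(3) LFor.prems N_def by auto
  have st_Suc: "st (Suc i) = run p (h i)" for i by (simp add: st_def h_def)
  have st_in: "st i ''in'' = s ''in''" for i
    by (induction i) (use well_formed well_formed_in_notin_mods in \<open>auto simp: st_def run_frame\<close>)
  have h_in: "h i ''in'' = s ''in''" for i using st_in well_formed by (simp add: h_def)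
  have h_Suc: "h (Suc i) = upd (st (Suc i)) x (Suc i)" for i by (simp add: h_def)
  have st_x: "st (Suc i) x 0 = i" for i
    using well_formed unfolding st_Suc by (simp add: run_frame h_def)
  have le: "b + i * Suc (steps p n) \<le> B" if "i \<le> N" for i
  proof -
    have "i * Suc (steps p n) \<le> n * Suc (steps p n)" using that Nn by (intro mult_right_mono) auto
    then show ?thesis using LFor.prems(5) by simp
  qed
  have body: "\<exists>t. exec (compile p) (h i) t (st (Suc i)) \<and> t \<le> time_bound p n B \<and>
      store_bits (st (Suc i)) (b + i * Suc (steps p n) + steps p n)"
    if "i < N" "store_bits (h i) (b + i * Suc (steps p n))" for i
    using LFor.IH[of "h i" "b + i * Suc (steps p n)"] that well_formed h_in LFor.prems le[of "Suc i"]
    by (auto simp: st_Suc)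
  have hb: "i \<le> N \<Longrightarrow> store_bits (h i) (b + i * Suc (steps p n))" for i
  proof (induction i)
    case 0
    have "store_bits (upd s x 0) b"
      using LFor.prems(2) store_bits_pos by (intro store_bits_upd) (auto simp: nbits_0)
    then show ?case by (simp add: h_def st_def del: fun_upd_apply)
  next
    case (Suc i)
    then have 1: "store_bits (st (Suc i)) (b + i * Suc (steps p n) + steps p n)"
      using body[of i] by auto
    then have "nbits (st (Suc i) x 0) \<le> b + i * Suc (steps p n) + steps p n"
      by (simp add: store_bits_def)
    then have "nbits (Suc i) \<le> b + Suc i * Suc (steps p n)"
      using nbits_Suc[of i] by (simp add: st_x)
    moreover have "store_bits (st (Suc i)) (b + Suc i * Suc (steps p n))"
      using 1 by (rule store_bits_mono) simp
    ultimately show ?case unfolding h_Suc by (intro store_bits_upd)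
  qed
  have hB: "store_bits (h i) B" if "i \<le> N" for i using hb[OF that] le[OF that] store_bits_mono by blast
  have aG: "aval G (h i) = N - i" for i
    using h_in by (simp add: G_def N_def) (simp add: h_def)
  \<comment> \<open>Induction on the number of remaining rounds, which is the value of the guard:
    the rule for a while loop peels off the first round, so the induction runs backwards from the
    exit.\<close>
  have loop: "i \<le> N \<Longrightarrow> \<exists>t. exec W (h (N - i)) t (h N) \<and> t \<le> 1 + time_bits G B + i * C" for i
  proof (induction i)
    case 0
    have "exec W (h N) (1 + atime G (h N)) (h N)"
      unfolding W_def using aG[of N] by (intro exec.WhileFalse) simp
    then show ?case using atime_le[OF hB[of N], of G] by auto
  next
    case (Suc i)
    define l where "l = N - Suc i"
    have l: "l < N" "N - i = Suc l" using Suc.prems by (auto simp: l_def)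
    obtain t1 where t1: "exec (compile p) (h l) t1 (st (Suc l))" "t1 \<le> time_bound p n B"
      and sb: "store_bits (st (Suc l)) (b + l * Suc (steps p n) + steps p n)"
      using body[of l] hb[of l] l by auto
    obtain t2 where t2: "exec W (h (Suc l)) t2 (h N)" "t2 \<le> 1 + time_bits G B + i * C"
      using Suc l by auto
    have "exec I (st (Suc l)) (1 + atime (Num 0) (st (Suc l)) +
        atime (Plus (scalar x) (Num 1)) (st (Suc l))) (h (Suc l))"
      (is "exec _ _ ?ti _")
      unfolding I_def h_Suc using exec.Assign[of x "Num 0" "Plus (scalar x) (Num 1)" "st (Suc l)"]
      by (simp add: st_x)
    then have "exec (Seq (compile p) I) (h l) (t1 + ?ti) (h (Suc l))"
      using t1(1) exec.Seq by blast
    then have ex: "exec W (h l) (1 + atime G (h l) + (t1 + ?ti) + t2) (h N)"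
      unfolding W_def using aG[of l] l t2(1) by (intro exec.WhileTrue) (auto simp: W_def)
    have "store_bits (st (Suc l)) B"
      using sb le[of "Suc l"] l by (auto intro: store_bits_mono)
    then have "?ti \<le> 1 + time_bits (Num 0) B + time_bits (Plus (scalar x) (Num 1)) B"
      using atime_le[of "st (Suc l)" B "Num 0"] atime_le[of "st (Suc l)" B "Plus (scalar x) (Num 1)"]
      by linarith
    moreover have "atime G (h l) \<le> time_bits G B" using hB l atime_le by simp
    ultimately have "1 + atime G (h l) + (t1 + ?ti) + t2 \<le> 1 + time_bits G B + Suc i * C"
      using t1(2) t2(2) unfolding C_def mult_Suc by linarith
    then show ?case using ex unfolding l_def[symmetric] by blast
  qed
  obtain t where t: "exec W (h 0) t (h N)" "t \<le> 1 + time_bits G B + N * C"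
    using loop[of N] by auto
  have run: "run (LFor x m p) s = h N" by (simp add: h_def st_def N_def)
  have h0: "h 0 = s(x := (s x)(aval (Num 0) s := aval (Num 0) s))" by (simp add: h_def st_def)
  have "exec (compile (LFor x m p)) s ((1 + atime (Num 0) s + atime (Num 0) s) + t) (h N)"
    using exec.Seq[OF exec.Assign[of x "Num 0" "Num 0" s] t(1)[unfolded h0]]
    by (simp add: W_def G_def I_def)
  moreover have "N * C \<le> n * C" using Nn by simp
  then have "(1 + atime (Num 0) s + atime (Num 0) s) + t \<le> time_bound (LFor x m p) n B"
    using t(2) unfolding time_bound.simps C_def G_def by simp
  moreover have "store_bits (h N) (b + steps (LFor x m p) n)"
    using hb[of N] Nn by (auto intro!: store_bits_mono[OF hb[of N]] mult_right_mono simp del: mult_Suc_right)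
  ultimately show ?case unfolding run by blast
qed

section \<open>Polynomial bounds in the input size\<close>

definition poly_bounded :: "(nat \<Rightarrow> nat) \<Rightarrow> bool" where
  "poly_bounded f \<longleftrightarrow> (\<exists>p :: nat poly. \<forall>n. f n \<le> poly p n)"

lemma poly_bounded_const: "poly_bounded (\<lambda>_. c)"
  unfolding poly_bounded_def by (rule exI[of _ "[:c:]"]) simp

lemma poly_bounded_id: "poly_bounded (\<lambda>n. n)"
  unfolding poly_bounded_def by (rule exI[of _ "[:0, 1:]"]) simp

lemma poly_bounded_add: "poly_bounded f \<Longrightarrow> poly_bounded g \<Longrightarrow> poly_bounded (\<lambda>n. f n + g n)"
  unfolding poly_bounded_def by (metis add_mono poly_add)

lemma poly_bounded_mult: "poly_bounded f \<Longrightarrow> poly_bounded g \<Longrightarrow> poly_bounded (\<lambda>n. f n * g n)"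
  unfolding poly_bounded_def by (metis mult_le_mono poly_mult)

lemma poly_bounded_Suc: "poly_bounded f \<Longrightarrow> poly_bounded (\<lambda>n. Suc (f n))"
  using poly_bounded_add[of f "\<lambda>_. 1"] poly_bounded_const by simp

lemmas poly_bounded_intros = poly_bounded_const poly_bounded_id poly_bounded_add poly_bounded_mult
  poly_bounded_Suc

lemma poly_bounded_val_bits: "poly_bounded b \<Longrightarrow> poly_bounded (\<lambda>n. val_bits e (b n))"
  by (induction e) (auto intro!: poly_bounded_intros)

lemma poly_bounded_time_bits: "poly_bounded b \<Longrightarrow> poly_bounded (\<lambda>n. time_bits e (b n))"
  by (induction e) (auto intro!: poly_bounded_intros poly_bounded_val_bits)

lemma poly_bounded_steps: "poly_bounded (\<lambda>n. steps p n)"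
  by (induction p) (auto intro!: poly_bounded_intros)

text \<open>The program is fixed, so each level of loop nesting contributes one more factor n and
  only raises the degree.\<close>

lemma poly_bounded_time_bound: "poly_bounded b \<Longrightarrow> poly_bounded (\<lambda>n. time_bound p n (b n))"
  by (induction p)
    (auto intro!: poly_bounded_intros poly_bounded_time_bits
      simp del: time_bits.simps)

lemma nbits_le_input_size: "x \<in> set xs \<Longrightarrow> nbits x \<le> input_size xs"
  unfolding input_size_def by (simp add: member_le_sum_list)

lemma exec_compile_init:
  assumes "well_formed p" "xs \<noteq> []" "init_store xs ''in'' 1 \<le> input_size xs"
    "init_store xs ''in'' 2 \<le> input_size xs"
  shows "\<exists>t. exec (compile p) (init_store xs) t (run p (init_store xs)) \<and>
    t \<le> time_bound p (input_size xs) (input_size xs + steps p (input_size xs))"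
proof -
  \<comment> \<open>An empty input would have size 0, whereas the cells outside the input hold 0,
    whose bit length is 1.\<close>
  have "nbits (hd xs) \<le> input_size xs" using assms(2) by (simp add: nbits_le_input_size)
  then have "1 \<le> input_size xs" using nbits_pos[of "hd xs"] by linarith
  then have "store_bits (init_store xs) (input_size xs)"
    unfolding store_bits_def init_store_def by (auto simp: nbits_0 nbits_le_input_size)
  then show ?thesis using exec_compile assms by blast
qed

section \<open>Greedy selection for a guessed radius\<close>

text \<open>The triangle inequality enters only through this four-point form, along the path i, j',
  i', j. Distances between two facilities or two clients never occur.\<close>

locale supplier =
  fixes nf nc k :: nat and L :: "nat \<Rightarrow> nat" and d :: "nat \<Rightarrow> nat \<Rightarrow> real"
  assumes dist_nonneg: "i < nf \<Longrightarrow> j < nc \<Longrightarrow> 0 \<le> d i j"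
    and dist_quad: "i < nf \<Longrightarrow> i' < nf \<Longrightarrow> j < nc \<Longrightarrow> j' < nc \<Longrightarrow> d i j \<le> d i j' + d i' j' + d i' j"
begin

definition solves :: "real \<Rightarrow> nat set \<Rightarrow> (nat \<Rightarrow> nat) \<Rightarrow> bool" where
  "solves B S \<sigma> \<longleftrightarrow> feasible {..<nf} {..<nc} L k S \<sigma> \<and> (\<forall>j<nc. d (\<sigma> j) j \<le> B)"

definition nbh :: "real \<Rightarrow> nat \<Rightarrow> nat set" where
  "nbh B i = {j. j < nc \<and> d i j \<le> B}"

definition selection :: "real \<Rightarrow> nat \<Rightarrow> nat set \<Rightarrow> bool" where
  "selection B m S \<longleftrightarrow> S \<subseteq> {..<nf} \<and> (\<forall>i\<in>S. L i \<le> card (nbh B i)) \<and>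
     (\<forall>i\<in>S. \<forall>i'\<in>S. i \<noteq> i' \<longrightarrow> nbh B i \<inter> nbh B i' = {}) \<and>
     (\<forall>j<m. \<exists>i\<in>S. d i j \<le> 3 * B)"

text \<open>The clients that triggered the opening of the facilities in S are served by pairwise
  different facilities in every solution of radius B; hence at most k facilities get opened.\<close>

definition triggered :: "real \<Rightarrow> (nat \<Rightarrow> nat) \<Rightarrow> nat set \<Rightarrow> nat \<Rightarrow> bool" where
  "triggered B \<sigma> S c \<longleftrightarrow>
     (\<exists>J \<subseteq> {..<nc}. card J = c \<and> inj_on \<sigma> J \<and> (\<forall>j\<in>J. \<exists>i\<in>S. d i j \<le> B))"

lemma finite_nbh: "finite (nbh B i)"
  unfolding nbh_def by simp

lemma selection_0: "selection B 0 {}"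
  unfolding selection_def by simp

lemma triggered_0: "triggered B \<sigma> {} 0"
  unfolding triggered_def by (rule exI[of _ "{}"]) simp

lemma selection_covered:
  "selection B m S \<Longrightarrow> i \<in> S \<Longrightarrow> d i m \<le> 3 * B \<Longrightarrow> selection B (Suc m) S"
  unfolding selection_def less_Suc_eq by blast

lemma selection_insert:
  assumes S: "selection B m S" and m: "m < nc" and far: "\<forall>i\<in>S. \<not> d i m \<le> 3 * B"
    and v: "v < nf" "d v m \<le> B" "L v \<le> card (nbh B v)"
  shows "selection B (Suc m) (insert v S)"
proof -
  have disj: "nbh B i \<inter> nbh B v = {}" if "i \<in> S" for i
  proof (rule ccontr)
    assume "nbh B i \<inter> nbh B v \<noteq> {}"
    then obtain j where j: "j < nc" "d i j \<le> B" "d v j \<le> B" unfolding nbh_def by auto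
    have "i < nf" using that S unfolding selection_def by auto
    then have "d i m \<le> d i j + d v j + d v m" using dist_quad[of i v m j] v m j by simp
    then have "d i m \<le> 3 * B" using j v by linarith
    then show False using far that by blast
  qed
  \<comment> \<open>Nonnegativity of B is not assumed; it follows from 0 \<le> \<open>d v m\<close>
    \<le> B.\<close>
  have "d v m \<le> 3 * B" using v(2) dist_nonneg[OF v(1) m] by linarith
  moreover have "\<forall>i\<in>insert v S. \<forall>i'\<in>insert v S. i \<noteq> i' \<longrightarrow> nbh B i \<inter> nbh B i' = {}"
    using S disj unfolding selection_def by (simp add: Int_commute)
  ultimately show ?thesis using S v unfolding selection_def less_Suc_eq by simp
qed

text \<open>All clients served by \<open>\<sigma> m\<close> lie in its neighbourhood, which is
  therefore at least as large as its lower bound.\<close>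

lemma solves_candidate:
  assumes sol: "solves B S \<sigma>" and m: "m < nc"
  shows "\<sigma> m < nf" "d (\<sigma> m) m \<le> B" "L (\<sigma> m) \<le> card (nbh B (\<sigma> m))"
proof -
  have S: "\<sigma> m \<in> S" "S \<subseteq> {..<nf}" and L: "L (\<sigma> m) \<le> card {j \<in> {..<nc}. \<sigma> j = \<sigma> m}"
    using sol m unfolding solves_def feasible_def by (simp_all add: Pi_iff)
  have sub: "{j \<in> {..<nc}. \<sigma> j = \<sigma> m} \<subseteq> nbh B (\<sigma> m)"
    using sol unfolding solves_def nbh_def by auto
  show "\<sigma> m < nf" using S by auto
  show "d (\<sigma> m) m \<le> B" using sol m unfolding solves_def by auto
  show "L (\<sigma> m) \<le> card (nbh B (\<sigma> m))"
    using L card_mono[OF finite_nbh sub] by linarith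
qed

text \<open>If m had the same server as an earlier trigger j, the path from the facility opened near
  j to j, on to the common server and to m would have three legs of length at most B. That facility
  would then cover m within 3B.\<close>

lemma triggered_insert:
  assumes sol: "solves B S' \<sigma>" and S: "S \<subseteq> {..<nf}" and t: "triggered B \<sigma> S c" and m: "m < nc"
    and far: "\<forall>i\<in>S. \<not> d i m \<le> 3 * B" and v: "d v m \<le> B"
  shows "triggered B \<sigma> (insert v S) (Suc c)"
proof -
  obtain J where J: "J \<subseteq> {..<nc}" "card J = c" "inj_on \<sigma> J" "\<forall>j\<in>J. \<exists>i\<in>S. d i j \<le> B"
    using t unfolding triggered_def by blast
  have "\<sigma> m < nf" using solves_candidate(1)[OF sol m] .
  have neq: "\<sigma> j \<noteq> \<sigma> m" if "j \<in> J" for j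
  proof
    assume eq: "\<sigma> j = \<sigma> m"
    from bspec[OF J(4) that] obtain i where i: "i \<in> S" "d i j \<le> B" by (rule bexE)
    have "i < nf" "j < nc" using i(1) that J(1) S by auto
    then have "d i m \<le> d i j + d (\<sigma> m) j + d (\<sigma> m) m"
      using dist_quad[of i "\<sigma> m" m j] \<open>\<sigma> m < nf\<close> m by simp
    moreover have "d (\<sigma> m) j \<le> B" "d (\<sigma> m) m \<le> B"
      using solves_candidate(2)[OF sol \<open>j < nc\<close>] solves_candidate(2)[OF sol m] eq by simp_all
    ultimately have "d i m \<le> 3 * B" using i(2) by linarith
    then show False using far i(1) by blast
  qed
  have fin: "finite J" using J(1) finite_subset by blast
  have "m \<notin> J" using neq by blast
  then have "card (insert m J) = Suc c" using fin J(2) by simp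
  moreover have "inj_on \<sigma> (insert m J)" unfolding inj_on_insert using J(3) neq by (metis DiffD1 imageE)
  moreover have "insert m J \<subseteq> {..<nc}" using J(1) m by simp
  moreover have "\<forall>j\<in>insert m J. \<exists>i\<in>insert v S. d i j \<le> B" using J(4) v by blast
  ultimately show ?thesis unfolding triggered_def by blast
qed

lemma triggered_le:
  assumes sol: "solves B S' \<sigma>" and t: "triggered B \<sigma> S c"
  shows "c \<le> k"
proof -
  obtain J where J: "J \<subseteq> {..<nc}" "card J = c" "inj_on \<sigma> J"
    using t unfolding triggered_def by blast
  have S': "\<sigma> ` J \<subseteq> S'" "finite S'" "card S' \<le> k"
    using sol J(1) finite_subset[of S' "{..<nf}"] unfolding solves_def feasible_def by auto
  then have "card (\<sigma> ` J) \<le> k" using card_mono le_trans by blast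
  then show ?thesis using card_image[OF J(3)] J(2) by simp
qed

text \<open>A client of \<open>nbh B i\<close> is sent to some selected facility within B, and
  disjointness leaves only i. So i receives its whole neighbourhood, which meets its lower
  bound.\<close>

lemma selection_solves:
  assumes S: "selection B nc S" and k: "card S \<le> k"
    and \<sigma>: "\<And>j. j < nc \<Longrightarrow> \<sigma> j \<in> S \<and> d (\<sigma> j) j \<le> 3 * B \<and> ((\<exists>i\<in>S. d i j \<le> B) \<longrightarrow> d (\<sigma> j) j \<le> B)"
  shows "solves (3 * B) S \<sigma>"
proof -
  have "L i \<le> card {j \<in> {..<nc}. \<sigma> j = i}" if i: "i \<in> S" for i
  proof -
    have "\<sigma> j = i" if "j \<in> nbh B i" for j
    proof -
      have "j \<in> nbh B (\<sigma> j)" "\<sigma> j \<in> S" using \<sigma>[of j] that i unfolding nbh_def by auto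
      then show ?thesis using S i that unfolding selection_def by blast
    qed
    then have "nbh B i \<subseteq> {j \<in> {..<nc}. \<sigma> j = i}" unfolding nbh_def by auto
    then have "card (nbh B i) \<le> card {j \<in> {..<nc}. \<sigma> j = i}" by (intro card_mono) auto
    then show ?thesis using S i unfolding selection_def by (meson le_trans)
  qed
  then show ?thesis using S k \<sigma> unfolding solves_def feasible_def selection_def by auto
qed

end

section \<open>Access to the encoded input\<close>

text \<open>The address of a numerator. Four header cells, two lists of length nf (locations and
  lower bounds) and one of length nc precede the distance matrix, which is stored row by row with
  two cells per entry.\<close>

definition pos :: "aexp \<Rightarrow> aexp \<Rightarrow> aexp" where
  "pos i j = Plus (Plus (Plus (Num 4) (Times (Num 2) (Cell ''in'' (Num 1)))) (Cell ''in'' (Num 2)))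
     (Times (Num 2) (Plus (Times (Cell ''in'' (Plus (Num 4) i)) (Cell ''in'' (Num 0)))
       (Cell ''in'' (Plus (Plus (Num 4) (Times (Num 2) (Cell ''in'' (Num 1)))) j))))"

definition numerator :: "aexp \<Rightarrow> aexp \<Rightarrow> aexp" where
  "numerator i j = Cell ''in'' (pos i j)"

definition denominator :: "aexp \<Rightarrow> aexp \<Rightarrow> aexp" where
  "denominator i j = Cell ''in'' (Plus (pos i j) (Num 1))"

definition bound :: "aexp \<Rightarrow> aexp" where
  "bound i = Cell ''in'' (Plus (Plus (Num 4) (Cell ''in'' (Num 1))) i)"

text \<open>\<open>far c i j p q\<close> compares the distance of i and j with c times the distance of p and q by
  cross-multiplication; it is nonzero iff the former is larger.\<close>

definition far :: "nat \<Rightarrow> aexp \<Rightarrow> aexp \<Rightarrow> aexp \<Rightarrow> aexp \<Rightarrow> aexp" where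
  "far c i j p q = Minus (Times (numerator i j) (denominator p q)) (Times (Num c) (Times (numerator p q) (denominator i j)))"

text \<open>Subtraction is truncated, so \<open>Minus (Num 1)\<close> is negation.\<close>

definition near :: "nat \<Rightarrow> aexp" where
  "near c = Minus (Num 1) (far c (scalar ''i'') (scalar ''j'') (scalar ''p'') (scalar ''q''))"

section \<open>Positions in the encoding\<close>

lemma length_concat_uniform:
  "(\<And>xs. xs \<in> set xss \<Longrightarrow> length xs = m) \<Longrightarrow> length (concat xss) = length xss * m"
  by (induction xss) auto

lemma nth_concat_uniform:
  assumes "\<And>xs. xs \<in> set xss \<Longrightarrow> length xs = m" "i < length xss" "j < m"
  shows "concat xss ! (i * m + j) = xss ! i ! j"
  using assms
proof (induction xss arbitrary: i)
  case (Cons xs xss)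
  then show ?case by (cases i) (auto simp: nth_append)
qed simp

lemma length_encode_rat: "length (encode_rat r) = 2"
  by (simp add: encode_rat_def split: prod.split)

definition encode_dists :: "inst \<Rightarrow> nat list" where
  "encode_dists I = concat [encode_rat (inst_dist I x y). x \<leftarrow> [0..<inst_points I], y \<leftarrow> [0..<inst_points I]]"

text \<open>The list is a concatenation of two-cell blocks, and the list of blocks is itself a
  concatenation of rows; equal lengths at both levels turn the lookup into index arithmetic.\<close>

lemma nth_encode_dists:
  assumes x: "x < inst_points I" and y: "y < inst_points I" and b: "b < 2"
  shows "encode_dists I ! (2 * (x * inst_points I + y) + b) = encode_rat (inst_dist I x y) ! b"
proof -
  let ?n = "inst_points I"
  let ?rows = "map (\<lambda>x. map (\<lambda>y. encode_rat (inst_dist I x y)) [0..<?n]) [0..<?n]"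
  have len: "length (concat ?rows) = ?n * ?n"
    by (subst length_concat_uniform[of _ ?n]) auto
  have row: "concat ?rows ! (x * ?n + y) = encode_rat (inst_dist I x y)"
    using x y by (subst nth_concat_uniform) auto
  have "x * ?n + y < Suc x * ?n" using y by simp
  also have "\<dots> \<le> ?n * ?n" using x by (intro mult_right_mono) auto
  finally have "concat (concat ?rows) ! ((x * ?n + y) * 2 + b) = concat ?rows ! (x * ?n + y) ! b"
    using b len by (intro nth_concat_uniform) (auto simp: length_encode_rat)
  then show ?thesis unfolding row encode_dists_def by (simp add: mult.commute)
qed

lemma length_encode_dists: "length (encode_dists I) = 2 * (inst_points I * inst_points I)"
proof -
  let ?n = "inst_points I"
  let ?rows = "map (\<lambda>x. map (\<lambda>y. encode_rat (inst_dist I x y)) [0..<?n]) [0..<?n]"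
  have len: "length (concat ?rows) = ?n * ?n"
    by (subst length_concat_uniform[of _ ?n]) auto
  have "length (concat (concat ?rows)) = length (concat ?rows) * 2"
    by (rule length_concat_uniform) (auto simp: length_encode_rat)
  then show ?thesis unfolding encode_dists_def len by simp
qed

lemma encode_eq:
  "encode I = [inst_points I, length (inst_fac I), length (inst_cli I), inst_k I]
     @ inst_fac I @ inst_lb I @ inst_cli I @ encode_dists I"
  unfolding encode_def encode_dists_def ..

lemma length_le_input_size: "length xs \<le> input_size xs"
  unfolding input_size_def
proof (induction xs)
  case (Cons x xs)
  then show ?case using nbits_pos[of x] by simp
qed simp

section \<open>Reading a valid instance\<close>

locale valid_instance =
  fixes I :: inst
  assumes valid: "valid_inst I"
begin

abbreviation "nf \<equiv> length (inst_fac I)"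
abbreviation "nc \<equiv> length (inst_cli I)"
abbreviation "L \<equiv> (\<lambda>i. inst_lb I ! i)"
abbreviation "d \<equiv> fc_dist I"
abbreviation "inp \<equiv> init_store (encode I) ''in''"

sublocale Metric_space "{..<inst_points I}" "\<lambda>x y. real_of_rat (inst_dist I x y)"
  using valid unfolding valid_inst_def by blast

lemma length_lb: "length (inst_lb I) = nf"
  using valid unfolding valid_inst_def by blast

lemma fac_lt: "i < nf \<Longrightarrow> inst_fac I ! i < inst_points I"
  using valid nth_mem unfolding valid_inst_def by blast

lemma cli_lt: "j < nc \<Longrightarrow> inst_cli I ! j < inst_points I"
  using valid nth_mem unfolding valid_inst_def by blast

sublocale supplier nf nc "inst_k I" L d
proof
  show "0 \<le> d i j" for i j unfolding fc_dist_def by (rule nonneg)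
  fix i i' j j' assume ij: "i < nf" "i' < nf" "j < nc" "j' < nc"
  let ?m = "\<lambda>x y. real_of_rat (inst_dist I x y)"
  let ?f = "\<lambda>i. inst_fac I ! i" and ?c = "\<lambda>i. inst_cli I ! i"
  have "?m (?f i) (?c j) \<le> ?m (?f i) (?f i') + ?m (?f i') (?c j)"
    using ij fac_lt cli_lt by (intro triangle) auto
  moreover have "?m (?f i) (?f i') \<le> ?m (?f i) (?c j') + ?m (?c j') (?f i')"
    using ij fac_lt cli_lt by (intro triangle) auto
  ultimately show "d i j \<le> d i j' + d i' j' + d i' j"
    unfolding fc_dist_def using commute[of "?c j'" "?f i'"] by linarith
qed

lemma length_encode: "length (encode I) = 4 + 2 * nf + nc + 2 * (inst_points I * inst_points I)"
  unfolding encode_eq by (simp add: length_lb length_encode_dists)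

lemma inp_header: "inp 0 = inst_points I" "inp (Suc 0) = nf" "inp 2 = nc" "inp 3 = inst_k I"
  unfolding init_store_def by (simp_all add: length_encode) (simp_all add: encode_eq)

lemma inp_fac: "i < nf \<Longrightarrow> inp (4 + i) = inst_fac I ! i"
  unfolding init_store_def by (simp add: length_encode) (simp add: encode_eq nth_append)

lemma inp_lb: "i < nf \<Longrightarrow> inp (4 + nf + i) = L i"
  unfolding init_store_def by (simp add: length_encode) (simp add: encode_eq nth_append length_lb)

lemma inp_cli: "j < nc \<Longrightarrow> inp (4 + 2 * nf + j) = inst_cli I ! j"
  unfolding init_store_def by (simp add: length_encode) (simp add: encode_eq nth_append length_lb)

lemma inp_dist:
  assumes x: "x < inst_points I" and y: "y < inst_points I" and b: "b < 2"
  shows "inp (4 + 2 * nf + nc + 2 * (x * inst_points I + y) + b) = encode_rat (inst_dist I x y) ! b"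
proof -
  let ?n = "inst_points I"
  have "x * ?n + y < Suc x * ?n" using y by simp
  also have "\<dots> \<le> ?n * ?n" using x by (intro mult_right_mono) auto
  finally have "x * ?n + y < ?n * ?n" .
  moreover have "2 * l + b < 2 * m" if "l < m" for l m using that b by linarith
  ultimately have "2 * (x * ?n + y) + b < 2 * (?n * ?n)" by blast
  moreover have "encode I ! (4 + 2 * nf + nc + l) = encode_dists I ! l" for l
    by (simp add: encode_eq nth_append length_lb)
  ultimately show ?thesis
    unfolding init_store_def using nth_encode_dists[OF x y b]
    by (simp add: length_encode add.assoc)
qed

lemma aval_bound:
  assumes "s ''in'' = inp" "aval i s < nf"
  shows "aval (bound i) s = L (aval i s)"
  using assms inp_lb[of "aval i s"] by (simp add: bound_def inp_header)

text \<open>Distances are nonnegative, so the conversion by \<open>nat\<close> in the encoding keeps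
  the numerator. The equation is multiplied out, as the comparison by cross-multiplication needs
  it.\<close>

lemma aval_num_den:
  assumes s: "s ''in'' = inp" and i: "aval i s < nf" and j: "aval j s < nc"
  shows "real (aval (numerator i j) s) = d (aval i s) (aval j s) * real (aval (denominator i j) s)"
    and "0 < aval (denominator i j) s"
proof -
  let ?x = "inst_fac I ! aval i s" and ?y = "inst_cli I ! aval j s"
  have xy: "?x < inst_points I" "?y < inst_points I" using i j fac_lt cli_lt by auto
  have pos: "aval (pos i j) s = 4 + 2 * nf + nc + 2 * (?x * inst_points I + ?y)"
    using s inp_fac[OF i] inp_cli[OF j] by (simp add: pos_def inp_header)
  obtain a b where q: "quotient_of (inst_dist I ?x ?y) = (a, b)" by fastforce
  have b: "0 < b" using quotient_of_denom_pos[OF q] .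
  have r: "inst_dist I ?x ?y = of_int a / of_int b" using quotient_of_div[OF q] .
  have "0 \<le> real_of_rat (inst_dist I ?x ?y)" by (rule nonneg)
  then have "0 \<le> inst_dist I ?x ?y" by (simp only: zero_le_of_rat_iff)
  then have a: "0 \<le> a" using b unfolding r by (simp add: zero_le_divide_iff)
  have num: "aval (numerator i j) s = nat a"
    using inp_dist[OF xy, of 0] pos s q by (simp add: numerator_def encode_rat_def)
  have den: "aval (denominator i j) s = nat b"
    using inp_dist[OF xy, of 1] pos s q by (simp add: denominator_def encode_rat_def)
  show "0 < aval (denominator i j) s" using b den by simp
  show "real (aval (numerator i j) s) = d (aval i s) (aval j s) * real (aval (denominator i j) s)"
    unfolding num den fc_dist_def r using a b by (simp add: of_rat_divide)
qed

lemma aval_far: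
  assumes s: "s ''in'' = inp" and ij: "aval i s < nf" "aval j s < nc"
    and pq: "aval p s < nf" "aval q s < nc"
  shows "aval (far c i j p q) s \<noteq> 0 \<longleftrightarrow>
    real c * d (aval p s) (aval q s) < d (aval i s) (aval j s)"
proof -
  let ?n1 = "aval (numerator i j) s" and ?d1 = "aval (denominator i j) s"
  let ?n2 = "aval (numerator p q) s" and ?d2 = "aval (denominator p q) s"
  let ?e1 = "d (aval i s) (aval j s)" and ?e2 = "d (aval p s) (aval q s)"
  have "aval (far c i j p q) s \<noteq> 0 \<longleftrightarrow> c * (?n2 * ?d1) < ?n1 * ?d2" by (auto simp: far_def)
  also have "\<dots> \<longleftrightarrow> real c * (real ?n2 * real ?d1) < real ?n1 * real ?d2"
    by (metis of_nat_less_iff of_nat_mult)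
  also have "\<dots> \<longleftrightarrow> (real c * ?e2) * (real ?d1 * real ?d2) < ?e1 * (real ?d1 * real ?d2)"
    unfolding aval_num_den(1)[OF s ij] aval_num_den(1)[OF s pq] by (simp add: algebra_simps)
  also have "\<dots> \<longleftrightarrow> real c * ?e2 < ?e1"
    using aval_num_den(2)[OF s ij] aval_num_den(2)[OF s pq] by (intro mult_less_cancel_right_pos) simp
  finally show ?thesis .
qed

lemma aval_near:
  assumes s: "s ''in'' = inp" and ij: "s ''i'' 0 < nf" "s ''j'' 0 < nc"
    and pq: "s ''p'' 0 < nf" "s ''q'' 0 < nc"
  shows "aval (near c) s \<noteq> 0 \<longleftrightarrow> d (s ''i'' 0) (s ''j'' 0) \<le> real c * d (s ''p'' 0) (s ''q'' 0)"
  using aval_far[of s "scalar ''i''" "scalar ''j''" "scalar ''p''" "scalar ''q''" c] assms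
  unfolding near_def by auto

end

section \<open>The program\<close>

abbreviation set_scalar :: "string \<Rightarrow> aexp \<Rightarrow> lp" where
  "set_scalar x e \<equiv> LAssign x (Num 0) e"

text \<open>Afterwards f is 0 if no facility i satisfies e, and otherwise one plus such a facility.\<close>

definition find_facility :: "aexp \<Rightarrow> lp" where
  "find_facility e = LSeq (set_scalar ''f'' (Num 0))
     (LFor ''i'' 1 (LIf e (set_scalar ''f'' (Plus (scalar ''i'') (Num 1))) LSkip))"

definition count_near :: lp where
  "count_near = LSeq (set_scalar ''g'' (Num 0))
     (LFor ''j'' 2 (LIf (near 1) (set_scalar ''g'' (Plus (scalar ''g'') (Num 1))) LSkip))"

text \<open>The sizes of the neighbourhoods are tabulated beforehand, because
  \<open>openable\<close> is an expression and cannot count. \<open>S\<close> must be cleared, as it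
  still holds the choice made for the previous radius.\<close>

definition prepare :: lp where
  "prepare = LFor ''i'' 1 (LSeq count_near
     (LSeq (LAssign ''G'' (scalar ''i'') (scalar ''g'')) (LAssign ''S'' (scalar ''i'') (Num 0))))"

text \<open>The product serves as conjunction.\<close>

definition chosen_near :: "nat \<Rightarrow> aexp" where
  "chosen_near c = Times (Cell ''S'' (scalar ''i'')) (near c)"

text \<open>With truncated subtraction, the inner \<open>Minus\<close> vanishes iff the lower bound
  is at most the tabulated size, and the outer one negates.\<close>

definition openable :: aexp where
  "openable = Times (near 1) (Minus (Num 1) (Minus (bound (scalar ''i'')) (Cell ''G'' (scalar ''i''))))"

text \<open>\<open>bad\<close> marks the radius as failed. \<open>cnt\<close> counts the openings;
  it is compared with k only after all clients have been scanned.\<close>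

definition cover_client :: lp where
  "cover_client = LSeq (find_facility (chosen_near 3)) (LIf (scalar ''f'') LSkip
     (LSeq (find_facility openable) (LIf (scalar ''f'')
       (LSeq (LAssign ''S'' (Minus (scalar ''f'') (Num 1)) (Num 1))
         (set_scalar ''cnt'' (Plus (scalar ''cnt'') (Num 1))))
       (set_scalar ''bad'' (Num 1)))))"

definition search :: lp where
  "search = LSeq (LSeq (set_scalar ''bad'' (Num 0)) (set_scalar ''cnt'' (Num 0)))
     (LSeq prepare (LFor ''j'' 2 cover_client))"

definition write_open :: lp where
  "write_open = LFor ''i'' 1 (LAssign ''out'' (scalar ''i'') (Cell ''S'' (scalar ''i'')))"

text \<open>A facility within B must be looked for before one within 3B: this preference is what
  gives each opened facility its whole neighbourhood.\<close>

definition write_assign :: lp where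
  "write_assign = LFor ''j'' 2 (LSeq (find_facility (chosen_near 1))
     (LSeq (LIf (scalar ''f'') LSkip (find_facility (chosen_near 3)))
       (LAssign ''out'' (Plus (Cell ''in'' (Num 1)) (scalar ''j'')) (Minus (scalar ''f'') (Num 1)))))"

definition record_best :: lp where
  "record_best = LSeq (LSeq (set_scalar ''best'' (Num 1))
       (LSeq (set_scalar ''bp'' (scalar ''p'')) (set_scalar ''bq'' (scalar ''q''))))
     (LSeq write_open write_assign)"

text \<open>The radius under test is the distance of facility p and client q. Once best is nonzero, bp and
  bq give the smallest radius that succeeded so far, and out holds its solution.\<close>

definition try_radius :: lp where
  "try_radius = LSeq search
     (LIf (Plus (Plus (scalar ''bad'') (Minus (scalar ''cnt'') (Cell ''in'' (Num 3))))
         (Times (scalar ''best'') (far 1 (scalar ''p'') (scalar ''q'') (scalar ''bp'') (scalar ''bq''))))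
       LSkip record_best)"

definition algorithm :: lp where
  "algorithm = LFor ''p'' 1 (LFor ''q'' 2 try_radius)"

section \<open>Variables written by each subprogram\<close>

lemma mods_find_facility: "mods (find_facility e) = {''f'', ''i''}"
  by (auto simp: find_facility_def)

lemma mods_count_near: "mods count_near = {''g'', ''j''}"
  by (auto simp: count_near_def)

lemma mods_prepare: "mods prepare = {''i'', ''g'', ''j'', ''G'', ''S''}"
  by (auto simp: prepare_def mods_count_near)

lemma mods_cover_client: "mods cover_client = {''f'', ''i'', ''S'', ''cnt'', ''bad''}"
  by (auto simp: cover_client_def mods_find_facility)

lemma mods_search: "mods search = {''f'', ''i'', ''S'', ''cnt'', ''bad'', ''g'', ''j'', ''G''}"
  by (auto simp: search_def mods_prepare mods_cover_client)

lemma mods_write_open: "mods write_open = {''i'', ''out''}"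
  by (auto simp: write_open_def)

lemma mods_write_assign: "mods write_assign = {''f'', ''i'', ''j'', ''out''}"
  by (auto simp: write_assign_def mods_find_facility)

lemma mods_record_best: "mods record_best = {''best'', ''bp'', ''bq'', ''f'', ''i'', ''j'', ''out''}"
  by (auto simp: record_best_def mods_write_open mods_write_assign)

lemma mods_try_radius: "mods try_radius =
    {''f'', ''i'', ''S'', ''cnt'', ''bad'', ''g'', ''j'', ''G'', ''best'', ''bp'', ''bq'', ''out''}"
  by (auto simp: try_radius_def mods_search mods_record_best)

lemma well_formed_find_facility: "well_formed (find_facility e)"
  by (simp add: find_facility_def)

lemma well_formed_algorithm: "well_formed algorithm"
  by (simp add: algorithm_def mods_try_radius)
    (simp add: try_radius_def search_def record_best_def prepare_def write_open_def
      write_assign_def cover_client_def count_near_def mods_find_facility well_formed_find_facility)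

section \<open>Correctness of the elementary searches\<close>

context valid_instance
begin

definition found :: "(nat \<Rightarrow> bool) \<Rightarrow> nat \<Rightarrow> bool" where
  "found P v \<longleftrightarrow> (if v = 0 then \<forall>i<nf. \<not> P i else v - 1 < nf \<and> P (v - 1))"

text \<open>The loop does not stop at a hit: \<open>f\<close> is overwritten and keeps the last one,
  and any hit suffices. The condition is evaluated only in stores that differ from s at most in
  \<open>f\<close> and \<open>i\<close>.\<close>

lemma run_find_facility:
  assumes s: "s ''in'' = inp"
    and e: "\<And>s'. (\<And>y. y \<notin> {''f'', ''i''} \<Longrightarrow> s' y = s y) \<Longrightarrow> s' ''i'' 0 < nf \<Longrightarrow>
      aval e s' \<noteq> 0 \<longleftrightarrow> P (s' ''i'' 0)"
  shows "found P (run (find_facility e) s ''f'' 0)"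
  unfolding find_facility_def run.simps(3)
proof (rule run_For[where n = nf and R = "\<lambda>s. found P (s ''f'' 0)" and
      Q = "\<lambda>m s. if s ''f'' 0 = 0 then \<forall>i<m. \<not> P i else s ''f'' 0 - 1 < nf \<and> P (s ''f'' 0 - 1)"])
  let ?b = "LIf e (set_scalar ''f'' (Plus (scalar ''i'') (Num 1))) LSkip"
  fix i s'
  assume i: "i < nf"
    and Q: "if s' ''f'' 0 = 0 then \<forall>l<i. \<not> P l else s' ''f'' 0 - 1 < nf \<and> P (s' ''f'' 0 - 1)"
    and frame: "\<And>y. y \<notin> insert ''i'' (mods ?b) \<Longrightarrow> s' y = run (set_scalar ''f'' (Num 0)) s y"
  let ?r = "run ?b (upd s' ''i'' i)"
  have "aval e (upd s' ''i'' i) \<noteq> 0 \<longleftrightarrow> P i"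
    using e[of "upd s' ''i'' i"] frame i by auto
  then show "if ?r ''f'' 0 = 0 then \<forall>l<Suc i. \<not> P l else ?r ''f'' 0 - 1 < nf \<and> P (?r ''f'' 0 - 1)"
    using Q i by (auto simp: less_Suc_eq)
qed (use s in \<open>auto simp: found_def inp_header\<close>)

definition chosen :: "store \<Rightarrow> nat set" where
  "chosen s = {i. i < nf \<and> s ''S'' i \<noteq> 0}"

definition ready :: "store \<Rightarrow> bool" where
  "ready s \<longleftrightarrow> s ''in'' = inp \<and> s ''p'' 0 < nf \<and> s ''q'' 0 < nc"

definition radius :: "store \<Rightarrow> real" where
  "radius s = d (s ''p'' 0) (s ''q'' 0)"

lemma ready_cong:
  "s' ''in'' = s ''in'' \<Longrightarrow> s' ''p'' = s ''p'' \<Longrightarrow> s' ''q'' = s ''q'' \<Longrightarrow> ready s' = ready s"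
  by (simp add: ready_def)

lemma radius_cong: "s' ''p'' = s ''p'' \<Longrightarrow> s' ''q'' = s ''q'' \<Longrightarrow> radius s' = radius s"
  by (simp add: radius_def)

lemma aval_near':
  "ready s \<Longrightarrow> s ''i'' 0 < nf \<Longrightarrow> s ''j'' 0 < nc \<Longrightarrow>
    aval (near c) s \<noteq> 0 \<longleftrightarrow> d (s ''i'' 0) (s ''j'' 0) \<le> real c * radius s"
  unfolding ready_def radius_def by (intro aval_near) auto

lemma run_find_chosen_near:
  assumes "ready s" "s ''j'' 0 < nc"
  shows "found (\<lambda>i. i \<in> chosen s \<and> d i (s ''j'' 0) \<le> real c * radius s)
    (run (find_facility (chosen_near c)) s ''f'' 0)"
proof (rule run_find_facility)
  fix s' :: store assume fr: "\<And>y. y \<notin> {''f'', ''i''} \<Longrightarrow> s' y = s y" and i: "s' ''i'' 0 < nf"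
  have "ready s'" "radius s' = radius s" "s' ''j'' = s ''j''" "s' ''S'' = s ''S''"
    using assms fr ready_cong[of s' s] radius_cong[of s' s] by auto
  then show "aval (chosen_near c) s' \<noteq> 0 \<longleftrightarrow>
      s' ''i'' 0 \<in> chosen s \<and> d (s' ''i'' 0) (s ''j'' 0) \<le> real c * radius s"
    using aval_near'[of s' c] i assms by (auto simp: chosen_near_def chosen_def)
qed (use assms in \<open>simp add: ready_def\<close>)

definition counted :: "store \<Rightarrow> bool" where
  "counted s \<longleftrightarrow> (\<forall>i<nf. s ''G'' i = card (nbh (radius s) i))"

lemma run_find_openable:
  assumes "ready s" "s ''j'' 0 < nc" "counted s"
  shows "found (\<lambda>i. d i (s ''j'' 0) \<le> radius s \<and> L i \<le> card (nbh (radius s) i))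
    (run (find_facility openable) s ''f'' 0)"
proof (rule run_find_facility)
  fix s' :: store assume fr: "\<And>y. y \<notin> {''f'', ''i''} \<Longrightarrow> s' y = s y" and i: "s' ''i'' 0 < nf"
  have "ready s'" "radius s' = radius s" "s' ''j'' = s ''j''" "s' ''G'' = s ''G''"
    using assms fr ready_cong[of s' s] radius_cong[of s' s] by auto
  moreover have "s' ''in'' = inp" using \<open>ready s'\<close> by (simp add: ready_def)
  ultimately show "aval openable s' \<noteq> 0 \<longleftrightarrow>
      d (s' ''i'' 0) (s ''j'' 0) \<le> radius s \<and> L (s' ''i'' 0) \<le> card (nbh (radius s) (s' ''i'' 0))"
    using aval_near'[of s' 1] aval_bound[of s' "scalar ''i''"] i assms
    by (auto simp: openable_def counted_def)
qed (use assms in \<open>simp add: ready_def\<close>)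

lemma run_count_near:
  assumes s: "ready s" "s ''i'' 0 < nf"
  shows "run count_near s ''g'' 0 = card (nbh (radius s) (s ''i'' 0))"
  unfolding count_near_def run.simps(3)
proof (rule run_For[where n = nc and R = "\<lambda>r. r ''g'' 0 = card (nbh (radius s) (s ''i'' 0))" and
      Q = "\<lambda>m r. r ''g'' 0 = card {j. j < m \<and> d (s ''i'' 0) j \<le> radius s}"])
  fix j s'
  let ?b = "LIf (near 1) (set_scalar ''g'' (Plus (scalar ''g'') (Num 1))) LSkip"
  assume j: "j < nc"
    and Q: "s' ''g'' 0 = card {j'. j' < j \<and> d (s ''i'' 0) j' \<le> radius s}"
    and frame: "\<And>y. y \<notin> insert ''j'' (mods ?b) \<Longrightarrow> s' y = run (set_scalar ''g'' (Num 0)) s y"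
  let ?r = "upd s' ''j'' j"
  have "ready ?r" "radius ?r = radius s" "?r ''i'' = s ''i''"
    using frame s ready_cong[of ?r s] radius_cong[of ?r s] by auto
  then have near: "aval (near 1) ?r \<noteq> 0 \<longleftrightarrow> d (s ''i'' 0) j \<le> radius s"
    using aval_near'[of ?r 1] s j by simp
  have "{j'. j' < Suc j \<and> d (s ''i'' 0) j' \<le> radius s} =
      (if d (s ''i'' 0) j \<le> radius s then insert j {j'. j' < j \<and> d (s ''i'' 0) j' \<le> radius s}
       else {j'. j' < j \<and> d (s ''i'' 0) j' \<le> radius s})"
    by (auto simp: less_Suc_eq)
  then show "run ?b ?r ''g'' 0 = card {j'. j' < Suc j \<and> d (s ''i'' 0) j' \<le> radius s}"
    using near Q by simp
qed (use s in \<open>auto simp: ready_def inp_header nbh_def\<close>)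

lemma run_prepare:
  assumes s: "ready s"
  shows "counted (run prepare s) \<and> chosen (run prepare s) = {}"
  unfolding prepare_def
proof (rule run_For[where n = nf and
      Q = "\<lambda>m r. \<forall>i<m. r ''G'' i = card (nbh (radius s) i) \<and> r ''S'' i = 0"])
  let ?b = "LSeq count_near
     (LSeq (LAssign ''G'' (scalar ''i'') (scalar ''g'')) (LAssign ''S'' (scalar ''i'') (Num 0)))"
  fix i s'
  assume i: "i < nf" and Q: "\<forall>l<i. s' ''G'' l = card (nbh (radius s) l) \<and> s' ''S'' l = 0"
    and frame: "\<And>y. y \<notin> insert ''i'' (mods ?b) \<Longrightarrow> s' y = s y"
  let ?r = "upd s' ''i'' i"
  have r: "ready ?r" "radius ?r = radius s"
    using frame s ready_cong[of ?r s] radius_cong[of ?r s] by (auto simp: mods_count_near)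
  have g: "run count_near ?r ''g'' 0 = card (nbh (radius s) i)"
    using run_count_near[OF r(1)] r(2) i by simp
  have fr: "run count_near ?r ''G'' = s' ''G''" "run count_near ?r ''S'' = s' ''S''"
    "run count_near ?r ''i'' 0 = i"
    by (simp_all add: run_frame mods_count_near)
  show "\<forall>l<Suc i. run ?b ?r ''G'' l = card (nbh (radius s) l) \<and> run ?b ?r ''S'' l = 0"
    using Q g fr by (auto simp: less_Suc_eq)
next
  fix s' :: store
  assume Q: "\<forall>i<nf. s' ''G'' i = card (nbh (radius s) i) \<and> s' ''S'' i = 0"
    and frame: "\<And>y. y \<notin> insert ''i'' (mods (LSeq count_near
     (LSeq (LAssign ''G'' (scalar ''i'') (scalar ''g'')) (LAssign ''S'' (scalar ''i'') (Num 0))))) \<Longrightarrow>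
     s' y = s y"
  let ?r = "upd s' ''i'' nf"
  have "radius ?r = radius s" using frame radius_cong[of ?r s] by (auto simp: mods_count_near)
  then show "counted ?r \<and> chosen ?r = {}" using Q by (auto simp: counted_def chosen_def)
qed (use s in \<open>simp_all add: ready_def inp_header\<close>)

section \<open>The greedy scan for one radius\<close>

text \<open>The first conjunct is soundness of a scan that has not failed, the second completeness:
  if some solution of radius B exists, the scan does not fail and \<open>cnt\<close> counts
  triggering clients. An inequality for the cardinality is enough, because it is \<open>cnt\<close>
  that gets compared with k.\<close>

definition greedy_inv :: "real \<Rightarrow> nat \<Rightarrow> store \<Rightarrow> bool" where
  "greedy_inv B m s \<longleftrightarrow>
     (s ''bad'' 0 = 0 \<longrightarrow> selection B m (chosen s) \<and> card (chosen s) \<le> s ''cnt'' 0) \<and>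
     (\<forall>S \<sigma>. solves B S \<sigma> \<longrightarrow> s ''bad'' 0 = 0 \<and> triggered B \<sigma> (chosen s) (s ''cnt'' 0))"

lemma finite_chosen: "finite (chosen s)"
  by (simp add: chosen_def)

lemma chosen_subset: "chosen s \<subseteq> {..<nf}"
  by (auto simp: chosen_def)

lemma chosen_cong: "s' ''S'' = s ''S'' \<Longrightarrow> chosen s' = chosen s"
  by (simp add: chosen_def)

lemma run_cover_client:
  assumes s: "ready s" "counted s" and m: "m = s ''j'' 0" "m < nc" and inv: "greedy_inv (radius s) m s"
  shows "greedy_inv (radius s) (Suc m) (run cover_client s)"
proof -
  let ?B = "radius s"
  define s1 where "s1 = run (find_facility (chosen_near 3)) s"
  have s1: "s1 y = s y" if "y \<notin> {''f'', ''i''}" for y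
    using that by (simp add: s1_def run_frame mods_find_facility)
  have f1: "found (\<lambda>i. i \<in> chosen s \<and> d i m \<le> 3 * ?B) (s1 ''f'' 0)"
    using run_find_chosen_near[of s 3] s m by (simp add: s1_def)
  have chosen1: "chosen s1 = chosen s" using s1 by (intro chosen_cong) simp
  show ?thesis
  proof (cases "s1 ''f'' 0 = 0")
    case False
    then obtain i where "i \<in> chosen s" "d i m \<le> 3 * ?B" using f1 by (auto simp: found_def)
    then have "greedy_inv ?B (Suc m) s1"
      using inv selection_covered[of ?B m "chosen s" i] s1 chosen1 by (simp add: greedy_inv_def)
    then show ?thesis using False by (simp add: cover_client_def s1_def)
  next
    case True
    define s2 where "s2 = run (find_facility openable) s1"
    have s2: "s2 y = s y" if "y \<notin> {''f'', ''i''}" for y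
      using that s1 by (simp add: s2_def run_frame mods_find_facility)
    have "ready s1" "radius s1 = ?B" "counted s1" "s1 ''j'' 0 = m"
      using s m s1 ready_cong[of s1 s] radius_cong[of s1 s] by (auto simp: counted_def)
    then have f2: "found (\<lambda>i. d i m \<le> ?B \<and> L i \<le> card (nbh ?B i)) (s2 ''f'' 0)"
      using run_find_openable[of s1] m by (simp add: s2_def)
    have far: "\<forall>i\<in>chosen s. \<not> d i m \<le> 3 * ?B"
      using True f1 chosen_subset by (auto simp: found_def)
    have chosen2: "chosen s2 = chosen s" using s2 by (intro chosen_cong) simp
    show ?thesis
    proof (cases "s2 ''f'' 0 = 0")
      case f2_0: True
      \<comment> \<open>The server of m in any solution would have been found, so no solution of
        this radius exists. Once \<open>bad\<close> is set, both halves of the invariant are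
        vacuous.\<close>
      have "\<not> solves ?B S \<sigma>" for S \<sigma>
        using f2 f2_0 solves_candidate[of ?B S \<sigma> m] m(2) by (auto simp: found_def)
      then show ?thesis using True f2_0
        by (simp add: cover_client_def greedy_inv_def flip: s1_def s2_def)
    next
      case f2_1: False
      define v where "v = s2 ''f'' 0 - 1"
      have v: "v < nf" "d v m \<le> ?B" "L v \<le> card (nbh ?B v)"
        using f2 f2_1 by (auto simp: found_def v_def)
      define s3 where "s3 = run cover_client s"
      have s3: "s3 ''S'' = (s ''S'')(v := 1)" "s3 ''cnt'' 0 = Suc (s ''cnt'' 0)"
        "s3 ''bad'' 0 = s ''bad'' 0"
        using True f2_1 s2 unfolding s3_def
        by (simp_all add: cover_client_def v_def flip: s1_def s2_def)
      have chosen3: "chosen s3 = insert v (chosen s)"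
        using s3(1) v(1) by (auto simp: chosen_def)
      have "card (insert v (chosen s)) \<le> Suc (card (chosen s))"
        using card_insert_le_m1 by (simp add: card_insert_if finite_chosen)
      then have "greedy_inv ?B (Suc m) s3"
        using inv selection_insert[OF _ m(2) far v] triggered_insert[OF _ chosen_subset _ m(2) far v(2)]
        unfolding greedy_inv_def chosen3 s3(2,3) by fastforce
      then show ?thesis by (simp add: s3_def)
    qed
  qed
qed

lemma run_search:
  assumes s: "ready s"
  shows "greedy_inv (radius s) nc (run search s)"
proof -
  define s0 where "s0 = run (LSeq (set_scalar ''bad'' (Num 0)) (set_scalar ''cnt'' (Num 0))) s"
  define s1 where "s1 = run prepare s0"
  have s0: "s0 ''bad'' 0 = 0" "s0 ''cnt'' 0 = 0" "ready s0" "radius s0 = radius s"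
    using s ready_cong[of s0 s] radius_cong[of s0 s] by (auto simp: s0_def)
  have "s1 y = s0 y" if "y \<notin> mods prepare" for y using that by (simp add: s1_def run_frame)
  then have s1: "s1 ''bad'' 0 = 0" "s1 ''cnt'' 0 = 0" "ready s1" "radius s1 = radius s"
    using s0 ready_cong[of s1 s0] radius_cong[of s1 s0] by (auto simp: mods_prepare)
  have prep: "counted s1" "chosen s1 = {}" using run_prepare[OF s0(3)] by (auto simp: s1_def)
  have "greedy_inv (radius s) nc (run (LFor ''j'' 2 cover_client) s1)"
  proof (rule run_For[where n = nc and Q = "greedy_inv (radius s)"])
    show "greedy_inv (radius s) 0 s1"
      using s1 prep selection_0 triggered_0 by (simp add: greedy_inv_def)
    show "s1 ''in'' 2 = nc" using s1(3) by (simp add: ready_def inp_header)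
  next
    fix j s'
    assume j: "j < nc" and inv: "greedy_inv (radius s) j s'"
      and frame: "\<And>y. y \<notin> insert ''j'' (mods cover_client) \<Longrightarrow> s' y = s1 y"
    let ?r = "upd s' ''j'' j"
    have "ready ?r" "radius ?r = radius s" "counted ?r"
      using frame s1 prep ready_cong[of ?r s1] radius_cong[of ?r s1]
      by (auto simp: mods_cover_client counted_def)
    moreover have "greedy_inv (radius s) j ?r"
      using inv chosen_cong[of ?r s'] by (simp add: greedy_inv_def)
    ultimately show "greedy_inv (radius s) (Suc j) (run cover_client ?r)"
      using run_cover_client[of ?r j] j by simp
  next
    fix s' assume "greedy_inv (radius s) nc s'"
    then show "greedy_inv (radius s) nc (upd s' ''j'' nc)"
      using chosen_cong[of "upd s' ''j'' nc" s'] by (simp add: greedy_inv_def)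
  qed
  then show ?thesis by (simp add: search_def s1_def s0_def)
qed

section \<open>Writing the solution\<close>

lemma run_write_open:
  assumes s: "ready s" and i: "i < nf"
  shows "run write_open s ''out'' i = s ''S'' i"
proof -
  have "\<forall>i<nf. run write_open s ''out'' i = s ''S'' i"
    unfolding write_open_def
  proof (rule run_For[where n = nf and Q = "\<lambda>m r. \<forall>i<m. r ''out'' i = s ''S'' i"])
    fix i s'
    assume "\<forall>l<i. s' ''out'' l = s ''S'' l"
      and "\<And>y. y \<notin> insert ''i'' (mods (LAssign ''out'' (scalar ''i'') (Cell ''S'' (scalar ''i'')))) \<Longrightarrow>
        s' y = s y"
    then show "\<forall>l<Suc i. run (LAssign ''out'' (scalar ''i'') (Cell ''S'' (scalar ''i''))) (upd s' ''i'' i)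
        ''out'' l = s ''S'' l"
      by (auto simp: less_Suc_eq)
  qed (use s in \<open>auto simp: ready_def inp_header\<close>)
  then show ?thesis using i by blast
qed

lemma run_write_assign:
  fixes s :: store
  defines "\<sigma> \<equiv> \<lambda>j. run write_assign s ''out'' (nf + j)"
  assumes s: "ready s" and cov: "\<And>j. j < nc \<Longrightarrow> \<exists>i\<in>chosen s. d i j \<le> 3 * radius s"
  shows "(\<forall>i<nf. run write_assign s ''out'' i = s ''out'' i) \<and>
    (\<forall>j<nc. \<sigma> j \<in> chosen s \<and> d (\<sigma> j) j \<le> 3 * radius s \<and>
      ((\<exists>i\<in>chosen s. d i j \<le> radius s) \<longrightarrow> d (\<sigma> j) j \<le> radius s))"
proof -
  define ok where "ok j v \<longleftrightarrow> v \<in> chosen s \<and> d v j \<le> 3 * radius s \<and>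
      ((\<exists>i\<in>chosen s. d i j \<le> radius s) \<longrightarrow> d v j \<le> radius s)" for j v
  let ?b = "LSeq (find_facility (chosen_near 1))
     (LSeq (LIf (scalar ''f'') LSkip (find_facility (chosen_near 3)))
       (LAssign ''out'' (Plus (Cell ''in'' (Num 1)) (scalar ''j'')) (Minus (scalar ''f'') (Num 1))))"
  have "(\<forall>i<nf. run write_assign s ''out'' i = s ''out'' i) \<and>
      (\<forall>j<nc. ok j (run write_assign s ''out'' (nf + j)))"
    unfolding write_assign_def
  proof (rule run_For[where n = nc and
        Q = "\<lambda>m r. (\<forall>i<nf. r ''out'' i = s ''out'' i) \<and> (\<forall>j<m. ok j (r ''out'' (nf + j)))"])
    fix j s'
    assume j: "j < nc"
      and Q: "(\<forall>i<nf. s' ''out'' i = s ''out'' i) \<and> (\<forall>l<j. ok l (s' ''out'' (nf + l)))"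
      and frame: "\<And>y. y \<notin> insert ''j'' (mods ?b) \<Longrightarrow> s' y = s y"
    define r where "r = upd s' ''j'' j"
    have r: "ready r" "radius r = radius s" "r ''j'' 0 = j" "chosen r = chosen s" "r ''out'' = s' ''out''"
      using frame s ready_cong[of r s] radius_cong[of r s] chosen_cong[of r s]
      by (auto simp: r_def mods_find_facility)
    define r1 where "r1 = run (find_facility (chosen_near 1)) r"
    have fr1: "r1 y = r y" if "y \<notin> {''f'', ''i''}" for y
      using that by (simp add: r1_def run_frame mods_find_facility)
    have r1: "ready r1" "radius r1 = radius s" "r1 ''j'' 0 = j" "chosen r1 = chosen s"
      "r1 ''out'' = s' ''out''"
      using fr1 r ready_cong[of r1 r] radius_cong[of r1 r] chosen_cong[of r1 r] by auto
    have f1: "found (\<lambda>i. i \<in> chosen s \<and> d i j \<le> radius s) (r1 ''f'' 0)"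
      using run_find_chosen_near[of r 1] r j by (simp add: r1_def)
    define r2 where "r2 = run (LIf (scalar ''f'') LSkip (find_facility (chosen_near 3))) r1"
    have fr2: "r2 y = r1 y" if "y \<notin> {''f'', ''i''}" for y
      using that by (simp add: r2_def run_frame mods_find_facility)
    have ok: "ok j (r2 ''f'' 0 - 1)"
    proof (cases "r1 ''f'' 0 = 0")
      case True
      have "found (\<lambda>i. i \<in> chosen s \<and> d i j \<le> 3 * radius s) (r2 ''f'' 0)"
        using run_find_chosen_near[of r1 3] r1 j True by (simp add: r2_def)
      \<comment> \<open>This excludes \<open>f\<close> = 0, for which the truncated \<open>f\<close>
        - 1 would name facility 0 by accident.\<close>
      moreover have "\<not> (\<forall>i<nf. \<not> (i \<in> chosen s \<and> d i j \<le> 3 * radius s))"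
        using cov[OF j] chosen_subset by blast
      ultimately have "r2 ''f'' 0 - 1 \<in> chosen s" "d (r2 ''f'' 0 - 1) j \<le> 3 * radius s"
        unfolding found_def by (auto split: if_splits)
      moreover have "\<not> (\<exists>i\<in>chosen s. d i j \<le> radius s)"
        using f1 True chosen_subset by (auto simp: found_def)
      ultimately show ?thesis by (simp add: ok_def)
    next
      case False
      then have v: "r2 ''f'' 0 - 1 \<in> chosen s" "d (r2 ''f'' 0 - 1) j \<le> radius s"
        using f1 by (auto simp: found_def r2_def)
      \<comment> \<open>Makes the radius nonnegative, so that being within the radius implies being
        within three times the radius.\<close>
      moreover have "0 \<le> d (r2 ''f'' 0 - 1) j"
        using v(1) j chosen_subset dist_nonneg by auto
      ultimately show ?thesis by (simp add: ok_def)
    qed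
    have "r2 ''in'' = inp" "r2 ''j'' 0 = j" "r2 ''out'' = s' ''out''"
      using fr2 r1 by (auto simp: ready_def)
    then have "run ?b r ''out'' = (s' ''out'')(nf + j := r2 ''f'' 0 - 1)"
      unfolding run.simps(3) r1_def[symmetric] r2_def[symmetric] by (simp add: inp_header)
    then show "(\<forall>i<nf. run ?b (upd s' ''j'' j) ''out'' i = s ''out'' i) \<and>
        (\<forall>l<Suc j. ok l (run ?b (upd s' ''j'' j) ''out'' (nf + l)))"
      using Q ok by (simp only: flip: r_def) (auto simp: less_Suc_eq)
  qed (use s in \<open>auto simp: ready_def inp_header\<close>)
  then show ?thesis unfolding ok_def \<sigma>_def .
qed

definition output_solves :: "real \<Rightarrow> (nat \<Rightarrow> nat) \<Rightarrow> bool" where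
  "output_solves B out \<longleftrightarrow> solves B {i. i < nf \<and> out i \<noteq> 0} (\<lambda>j. out (nf + j))"

lemma run_record_best:
  assumes s: "ready s" and sel: "selection (radius s) nc (chosen s)" "card (chosen s) \<le> inst_k I"
  shows "output_solves (3 * radius s) (run record_best s ''out'')"
    "run record_best s ''best'' 0 = 1"
    "run record_best s ''bp'' 0 = s ''p'' 0" "run record_best s ''bq'' 0 = s ''q'' 0"
proof -
  define r where "r = run (LSeq (set_scalar ''best'' (Num 1))
       (LSeq (set_scalar ''bp'' (scalar ''p'')) (set_scalar ''bq'' (scalar ''q'')))) s"
  have run: "run record_best s = run write_assign (run write_open r)"
    by (simp add: record_best_def r_def)
  have r: "ready r" "radius r = radius s" "r ''S'' = s ''S''"
    using s ready_cong[of r s] radius_cong[of r s] by (auto simp: r_def)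
  define w where "w = run write_open r"
  have fr: "w y = r y" if "y \<notin> {''i'', ''out''}" for y
    using that by (simp add: w_def run_frame mods_write_open)
  have w: "ready w" "radius w = radius s" "chosen w = chosen s"
    using fr r ready_cong[of w r] radius_cong[of w r] chosen_cong[of w s] by auto
  have w_out: "w ''out'' i = s ''S'' i" if "i < nf" for i
    using run_write_open[OF r(1) that] r(3) by (simp add: w_def)
  let ?out = "run write_assign w ''out''"
  have wa: "(\<forall>i<nf. ?out i = w ''out'' i) \<and>
    (\<forall>j<nc. ?out (nf + j) \<in> chosen s \<and> d (?out (nf + j)) j \<le> 3 * radius s \<and>
      ((\<exists>i\<in>chosen s. d i j \<le> radius s) \<longrightarrow> d (?out (nf + j)) j \<le> radius s))"
    using run_write_assign[OF w(1)] sel(1) w(2,3) by (simp add: selection_def)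
  have "{i. i < nf \<and> ?out i \<noteq> 0} = chosen s" using wa w_out by (auto simp: chosen_def)
  then have "output_solves (3 * radius s) ?out"
    unfolding output_solves_def using selection_solves[OF sel, of "\<lambda>j. ?out (nf + j)"] wa by simp
  then show "output_solves (3 * radius s) (run record_best s ''out'')" by (simp add: run w_def)
  show "run record_best s ''best'' 0 = 1"
    "run record_best s ''bp'' 0 = s ''p'' 0" "run record_best s ''bq'' 0 = s ''q'' 0"
    unfolding run by (simp_all add: run_frame mods_write_assign mods_write_open r_def)
qed

section \<open>The best radius over all pairs\<close>

definition best_radius :: "store \<Rightarrow> real" where
  "best_radius s = d (s ''bp'' 0) (s ''bq'' 0)"

text \<open>X collects the pairs tried so far. The all-zero output, which opens no facility, is kept
  track of for instances without clients, where no radius is ever tried.\<close>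

definition best_inv :: "(nat \<times> nat) set \<Rightarrow> store \<Rightarrow> bool" where
  "best_inv X s \<longleftrightarrow>
     (if s ''best'' 0 = 0 then s ''out'' = (\<lambda>_. 0)
      else s ''bp'' 0 < nf \<and> s ''bq'' 0 < nc \<and> output_solves (3 * best_radius s) (s ''out'')) \<and>
     (\<forall>(p, q)\<in>X. \<forall>S \<sigma>. solves (d p q) S \<sigma> \<longrightarrow> s ''best'' 0 \<noteq> 0 \<and> best_radius s \<le> d p q)"

lemma best_inv_cong:
  "s' ''best'' = s ''best'' \<Longrightarrow> s' ''out'' = s ''out'' \<Longrightarrow> s' ''bp'' = s ''bp'' \<Longrightarrow> s' ''bq'' = s ''bq'' \<Longrightarrow>
    best_inv X s' = best_inv X s"
  by (simp add: best_inv_def best_radius_def)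

lemma run_try_radius:
  assumes s: "ready s" and inv: "best_inv X s"
  shows "best_inv (insert (s ''p'' 0, s ''q'' 0) X) (run try_radius s)"
proof -
  let ?p = "s ''p'' 0" and ?q = "s ''q'' 0"
  define r where "r = run search s"
  have fr: "r y = s y" if "y \<notin> mods search" for y using that by (simp add: r_def run_frame)
  have r: "ready r" "radius r = radius s" "best_inv X r" "r ''p'' 0 = ?p" "r ''q'' 0 = ?q"
    using fr s inv ready_cong[of r s] radius_cong[of r s] best_inv_cong[of r s]
    by (simp_all add: mods_search)
  have g: "greedy_inv (radius s) nc r" using run_search[OF s] by (simp add: r_def)
  have rin: "r ''in'' = inp" using r(1) by (simp add: ready_def)
  let ?far = "far 1 (scalar ''p'') (scalar ''q'') (scalar ''bp'') (scalar ''bq'')"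
  have far: "aval ?far r \<noteq> 0 \<longleftrightarrow> best_radius r < radius s" if "r ''best'' 0 \<noteq> 0"
  proof -
    have "r ''bp'' 0 < nf" "r ''bq'' 0 < nc" using r(3) that by (auto simp: best_inv_def)
    then show ?thesis
      using aval_far[of r "scalar ''p''" "scalar ''q''" "scalar ''bp''" "scalar ''bq''" 1] r(1,2)
      by (auto simp: ready_def radius_def best_radius_def)
  qed
  \<comment> \<open>The condition for skipping is a sum, that is, a disjunction: the scan failed,
    too many facilities were opened, or a strictly smaller radius is on record.\<close>
  have run: "run try_radius s =
    (if r ''bad'' 0 = 0 \<and> r ''cnt'' 0 \<le> inst_k I \<and> (r ''best'' 0 = 0 \<or> aval ?far r = 0)
     then run record_best r else r)"
    by (simp add: try_radius_def inp_header rin flip: r_def)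
  have succ: "r ''bad'' 0 = 0 \<and> r ''cnt'' 0 \<le> inst_k I" if "solves (radius s) S \<sigma>" for S \<sigma>
    using g that triggered_le[OF that] unfolding greedy_inv_def by blast
  show ?thesis
  proof (cases "r ''bad'' 0 = 0 \<and> r ''cnt'' 0 \<le> inst_k I \<and> (r ''best'' 0 = 0 \<or> aval ?far r = 0)")
    case True
    then have "selection (radius r) nc (chosen r)" "card (chosen r) \<le> inst_k I"
      using g r(2) unfolding greedy_inv_def by auto
    note rec = run_record_best[OF r(1) this]
    define b where "b = run record_best r"
    have b: "best_radius b = radius s" "b ''best'' 0 = 1" "output_solves (3 * radius s) (b ''out'')"
      "b ''bp'' 0 < nf" "b ''bq'' 0 < nc"
      using rec r s by (simp_all add: b_def best_radius_def radius_def ready_def)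
    \<comment> \<open>A record is replaced only by a radius that is no larger, so what held for the
      earlier pairs persists.\<close>
    have "radius s \<le> d p q" if "(p, q) \<in> X" "solves (d p q) S \<sigma>" for p q S \<sigma>
    proof -
      have "r ''best'' 0 \<noteq> 0" "best_radius r \<le> d p q"
        using r(3) that unfolding best_inv_def by blast+
      then show ?thesis using True far by auto
    qed
    then have "best_inv (insert (?p, ?q) X) b"
      using b unfolding best_inv_def by (auto simp: radius_def)
    then show ?thesis unfolding run b_def using True by simp
  next
    case False
    \<comment> \<open>By \<open>succ\<close> the scan itself succeeded, so the only reason left for
      skipping is a smaller radius already on record.\<close>
    have "r ''best'' 0 \<noteq> 0 \<and> best_radius r \<le> d ?p ?q" if "solves (d ?p ?q) S \<sigma>" for S \<sigma>
    proof -
      have "r ''best'' 0 \<noteq> 0" "aval ?far r \<noteq> 0"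
        using succ[of S \<sigma>] that False by (auto simp: radius_def)
      then show ?thesis using far by (auto simp: radius_def)
    qed
    then have "best_inv (insert (?p, ?q) X) r"
      using r(3) unfolding best_inv_def by auto
    then show ?thesis unfolding run using False by auto
  qed
qed

lemma run_algorithm: "best_inv ({..<nf} \<times> {..<nc}) (run algorithm (init_store (encode I)))"
  unfolding algorithm_def
proof (rule run_For[where n = nf and Q = "\<lambda>p. best_inv ({..<p} \<times> {..<nc})"])
  show "best_inv ({..<0} \<times> {..<nc}) (init_store (encode I))"
    by (auto simp: best_inv_def init_store_def)
next
  fix p s
  assume p: "p < nf" and inv: "best_inv ({..<p} \<times> {..<nc}) s"
    and frame: "\<And>y. y \<notin> insert ''p'' (mods (LFor ''q'' 2 try_radius)) \<Longrightarrow> s y = init_store (encode I) y"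
  let ?s = "upd s ''p'' p"
  have s_in: "?s ''in'' = inp" using frame by (simp add: mods_try_radius)
  show "best_inv ({..<Suc p} \<times> {..<nc}) (run (LFor ''q'' 2 try_radius) ?s)"
  proof (rule run_For[where n = nc and Q = "\<lambda>q. best_inv ({..<p} \<times> {..<nc} \<union> {p} \<times> {..<q})"])
    show "?s ''in'' 2 = nc" using s_in by (simp add: inp_header)
    show "best_inv ({..<p} \<times> {..<nc} \<union> {p} \<times> {..<0}) ?s" using inv best_inv_cong[of ?s s] by simp
  next
    fix q s'
    assume q: "q < nc" and inv': "best_inv ({..<p} \<times> {..<nc} \<union> {p} \<times> {..<q}) s'"
      and frame': "\<And>y. y \<notin> insert ''q'' (mods try_radius) \<Longrightarrow> s' y = ?s y"
    let ?r = "upd s' ''q'' q"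
    have r: "?r ''in'' = inp" "?r ''p'' 0 = p" using frame' s_in by (simp_all add: mods_try_radius)
    then have "ready ?r" using p q by (simp add: ready_def)
    moreover have "best_inv ({..<p} \<times> {..<nc} \<union> {p} \<times> {..<q}) ?r"
      using inv' best_inv_cong[of ?r s'] by simp
    ultimately have "best_inv (insert (p, q) ({..<p} \<times> {..<nc} \<union> {p} \<times> {..<q})) (run try_radius ?r)"
      using run_try_radius[of ?r] r by simp
    moreover have "insert (p, q) ({..<p} \<times> {..<nc} \<union> {p} \<times> {..<q}) =
        {..<p} \<times> {..<nc} \<union> {p} \<times> {..<Suc q}" by auto
    ultimately show "best_inv ({..<p} \<times> {..<nc} \<union> {p} \<times> {..<Suc q}) (run try_radius ?r)" by simp
  next
    fix s' assume "best_inv ({..<p} \<times> {..<nc} \<union> {p} \<times> {..<nc}) s'"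
    moreover have "{..<p} \<times> {..<nc} \<union> {p} \<times> {..<nc} = {..<Suc p} \<times> {..<nc}" by auto
    ultimately show "best_inv ({..<Suc p} \<times> {..<nc}) (upd s' ''q'' nc)"
      using best_inv_cong[of "upd s' ''q'' nc" s'] by simp
  qed
next
  fix s' assume "best_inv ({..<nf} \<times> {..<nc}) s'"
  then show "best_inv ({..<nf} \<times> {..<nc}) (upd s' ''p'' nf)"
    using best_inv_cong[of "upd s' ''p'' nf" s'] by simp
qed (simp add: inp_header)

section \<open>The optimum and the approximation guarantee\<close>

lemma cost_set:
  assumes "feasible {..<nf} {..<nc} L (inst_k I) S \<sigma>"
  defines "A \<equiv> insert 0 {d i j | i j. i \<in> S \<and> j \<in> {..<nc} \<and> \<sigma> j = i}"
  shows "finite A" and "A = insert 0 ((\<lambda>j. d (\<sigma> j) j) ` {..<nc})"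
proof -
  show "A = insert 0 ((\<lambda>j. d (\<sigma> j) j) ` {..<nc})"
    using assms(1) unfolding A_def feasible_def by auto
  then show "finite A" by simp
qed

text \<open>The bound must be nonnegative because the cost is a maximum over a set that contains
  0.\<close>

lemma cost_le:
  assumes sol: "solves B S \<sigma>" and B: "0 \<le> B"
  shows "inst_feasible I S \<sigma>" "inst_cost I S \<sigma> \<le> B"
proof -
  show f: "inst_feasible I S \<sigma>"
    using sol by (simp add: solves_def inst_feasible_def facilities_def clients_def)
  have "feasible {..<nf} {..<nc} L (inst_k I) S \<sigma>" using sol by (simp add: solves_def)
  from cost_set[OF this] show "inst_cost I S \<sigma> \<le> B"
    using sol B by (auto simp: inst_cost_def cost_def clients_def solves_def)
qed

lemma opt_solves:
  assumes ex: "\<exists>S \<sigma>. inst_feasible I S \<sigma>"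
  obtains S \<sigma> where "solves (inst_opt I) S \<sigma>" "inst_cost I S \<sigma> = inst_opt I"
proof -
  obtain S \<sigma> where f: "feasible {..<nf} {..<nc} L (inst_k I) S \<sigma>"
    and opt: "cost d {..<nc} S \<sigma> = inst_opt I"
    using opt_cost_attained[of "{..<nf}" "{..<nc}" L "inst_k I" d] ex
    unfolding inst_feasible_def inst_opt_def facilities_def clients_def by auto
  have "d (\<sigma> j) j \<le> cost d {..<nc} S \<sigma>" if "j < nc" for j
    unfolding cost_def cost_set(2)[OF f] using that by (intro Max_ge) auto
  then have "solves (inst_opt I) S \<sigma>" using f opt by (simp add: solves_def)
  then show ?thesis using opt that by (simp add: inst_cost_def clients_def)
qed

text \<open>The maximum may be attained by the added element 0. Then client 0 is served at a
  distance between 0 and the optimum 0, so the optimum is a distance in this case as well.\<close>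

lemma opt_is_distance:
  assumes ex: "\<exists>S \<sigma>. inst_feasible I S \<sigma>" and nc: "0 < nc"
  shows "\<exists>p<nf. \<exists>q<nc. inst_opt I = d p q"
proof -
  obtain S \<sigma> where sol: "solves (inst_opt I) S \<sigma>" and cost: "inst_cost I S \<sigma> = inst_opt I"
    using opt_solves[OF ex] .
  have f: "feasible {..<nf} {..<nc} L (inst_k I) S \<sigma>" using sol by (simp add: solves_def)
  have "inst_opt I \<in> insert 0 ((\<lambda>j. d (\<sigma> j) j) ` {..<nc})"
    unfolding cost[symmetric] inst_cost_def cost_def clients_def cost_set(2)[OF f] by (rule Max_in) auto
  moreover have "d (\<sigma> 0) 0 \<le> inst_opt I" "0 \<le> d (\<sigma> 0) 0"
    using solves_candidate[OF sol nc] dist_nonneg nc by auto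
  ultimately consider "inst_opt I = d (\<sigma> 0) 0" | j where "j < nc" "inst_opt I = d (\<sigma> j) j" by force
  then show ?thesis using solves_candidate(1)[OF sol] nc by metis
qed

lemma algorithm_approximates:
  assumes ex: "\<exists>S \<sigma>. inst_feasible I S \<sigma>"
  defines "out \<equiv> run algorithm (init_store (encode I)) ''out''"
  shows "inst_feasible I (decode_open I out) (decode_assign I out) \<and>
    inst_cost I (decode_open I out) (decode_assign I out) \<le> 3 * inst_opt I"
proof -
  define s where "s = run algorithm (init_store (encode I))"
  have inv: "best_inv ({..<nf} \<times> {..<nc}) s" using run_algorithm by (simp add: s_def)
  have dec: "decode_open I out = {i. i < nf \<and> out i \<noteq> 0}" "decode_assign I out = (\<lambda>j. out (nf + j))"
    by (auto simp: decode_open_def decode_assign_def facilities_def)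
  obtain S \<sigma> where sol: "solves (inst_opt I) S \<sigma>" using opt_solves[OF ex] .
  have "\<exists>B\<ge>0. B \<le> 3 * inst_opt I \<and> output_solves B out"
  proof (cases "nc = 0")
    case True
    \<comment> \<open>A recorded client index would have to be below nc = 0, so nothing was
      recorded. The output then decodes to the empty set of facilities, which is feasible when there
      are no clients.\<close>
    then have "s ''out'' = (\<lambda>_. 0)" using inv by (auto simp: best_inv_def split: if_splits)
    then have "output_solves 0 out"
      unfolding output_solves_def solves_def feasible_def using True by (simp add: out_def s_def)
    moreover obtain S \<sigma> where "inst_cost I S \<sigma> = inst_opt I" "solves (inst_opt I) S \<sigma>"
      using opt_solves[OF ex] by metis
    then have "0 \<le> inst_opt I"
      using cost_set(1)[of S \<sigma>] True
      by (simp add: inst_cost_def cost_def clients_def flip: \<open>inst_cost I S \<sigma> = inst_opt I\<close>)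
    ultimately show ?thesis by auto
  next
    case False
    then obtain p q where pq: "p < nf" "q < nc" "inst_opt I = d p q"
      using opt_is_distance[OF ex] by auto
    then have best: "s ''best'' 0 \<noteq> 0" "best_radius s \<le> inst_opt I"
      using inv sol unfolding best_inv_def by force+
    then have "output_solves (3 * best_radius s) out" "0 \<le> best_radius s"
      using inv dist_nonneg by (auto simp: best_inv_def best_radius_def out_def s_def)
    then show ?thesis using best by (intro exI[of _ "3 * best_radius s"]) auto
  qed
  then show ?thesis using cost_le unfolding dec output_solves_def by (meson order_trans)
qed

text \<open>Every list element costs at least one bit, so nf and nc, which are at most the length of
  the encoding, are at most its size.\<close>

lemma exec_algorithm:
  shows "\<exists>t. exec (compile algorithm) (init_store (encode I)) t (run algorithm (init_store (encode I))) \<and>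
    t \<le> time_bound algorithm (input_size (encode I))
      (input_size (encode I) + steps algorithm (input_size (encode I)))"
proof (rule exec_compile_init[OF well_formed_algorithm])
  show "encode I \<noteq> []" by (simp add: encode_eq)
  show "inp 1 \<le> input_size (encode I)" "inp 2 \<le> input_size (encode I)"
    using length_le_input_size[of "encode I"] by (simp_all add: inp_header length_encode)
qed

end

theorem mainTheorem3:
  shows "\<exists>alg :: com.
    poly_time_on alg (encode ` {I. valid_inst I}) \<and>
    (\<forall>I. valid_inst I \<and> (\<exists>S \<sigma>. inst_feasible I S \<sigma>) \<longrightarrow>
       (\<exists>out. returns alg (encode I) out \<and>
          inst_feasible I (decode_open I out) (decode_assign I out) \<and>
          inst_cost I (decode_open I out) (decode_assign I out) \<le> 3 * inst_opt I))"
proof (intro exI[of _ "compile algorithm"] conjI allI impI)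
  have "poly_bounded (\<lambda>n. time_bound algorithm n (n + steps algorithm n))"
    by (intro poly_bounded_time_bound poly_bounded_add poly_bounded_id poly_bounded_steps)
  then obtain P :: "nat poly" where P: "\<And>n. time_bound algorithm n (n + steps algorithm n) \<le> poly P n"
    unfolding poly_bounded_def by blast
  have "\<exists>t s. exec (compile algorithm) (init_store (encode I)) t s \<and> t \<le> poly P (input_size (encode I))"
    if "valid_inst I" for I
    using valid_instance.exec_algorithm[of I] that P le_trans unfolding valid_instance_def by blast
  then show "poly_time_on (compile algorithm) (encode ` {I. valid_inst I})"
    unfolding poly_time_on_def by blast
next
  fix I assume I: "valid_inst I \<and> (\<exists>S \<sigma>. inst_feasible I S \<sigma>)"
  then interpret valid_instance I by unfold_locales simp
  have "returns (compile algorithm) (encode I) (run algorithm (init_store (encode I)) ''out'')"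
    unfolding returns_def using exec_algorithm by blast
  then show "\<exists>out. returns (compile algorithm) (encode I) out \<and>
      inst_feasible I (decode_open I out) (decode_assign I out) \<and>
      inst_cost I (decode_open I out) (decode_assign I out) \<le> 3 * inst_opt I"
    using algorithm_approximates I by blast
qed

end
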